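(* Every lacunary hyperbolic group $G$ with property $(\mathrm{F}\mathbb{R})$ is co-Hopfian, i.e. every injective endomorphism of $G$ is an automorphism of $G$.
   Context: A finitely generated group $G$ is lacunary hyperbolic if at least one of its asymptotic cones is an $\mathbb{R}$-tree (an asymptotic cone of $G$ is an ultralimit, with respect to a non-principal ultrafilter $\omega$ on $\mathbb{N}$, of the pointed metric spaces $(G,\frac{1}{d_n}\mathrm{dist}_S,1)$, where $\mathrm{dist}_S$ is the word metric of a finite generating set $S$ and $d_n\to\infty$). Equivalently (Ol'shanskii–Osin–Sapir), for some finite generating set $S$, $(G,S)$ is the direct limit of a sequence of groups with finite generating sets and epimorphisms $\alpha_k\colon (G_k,S_k)\to(G_{k+1},S_{k+1})$, $k\in\mathbb{N}$, with $\alpha_k(S_k)=S_{k+1}$, such that the Cayley graph of $G_k$ with respect to $S_k$ is $\delta_k$-hyperbolic ($\delta_k>0$; every side of a geodesic triangle lies in the $\delta_k$-neighbourhood of the union of the other two) and $\mathrm{inj}(\eta_k)/\delta_k\to\infty$. Here $\eta_k\colon G_k\to G$ is the natural epimorphism and $\mathrm{inj}(\eta_k)\in\mathbb{N}\cup\{\infty\}$ is the largest $R$ such that $\eta_k$ is injective on every ball of radius $R$ of $G_k$ for the word metric of $S_k$. A group $G$ has property $(\mathrm{F}\mathbb{R})$ if every action of $G$ by isometries on an $\mathbb{R}$-tree has a global fixed point. *)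

theory Defs
  imports "HOL-Analysis.Analysis" "HOL-Algebra.Generated_Groups" "HOL-Algebra.Group_Action"
begin

section \<open>Real trees\<close>

definition geodesic_path :: "'t set \<Rightarrow> ('t \<Rightarrow> 't \<Rightarrow> real) \<Rightarrow> 't \<Rightarrow> 't \<Rightarrow> (real \<Rightarrow> 't) \<Rightarrow> bool" where
  "geodesic_path M d x y c \<longleftrightarrow>
     c \<in> {0..d x y} \<rightarrow> M \<and> c 0 = x \<and> c (d x y) = y \<and>
     (\<forall>s\<in>{0..d x y}. \<forall>t\<in>{0..d x y}. d (c s) (c t) = \<bar>s - t\<bar>)"

definition arc_path :: "'t set \<Rightarrow> ('t \<Rightarrow> 't \<Rightarrow> real) \<Rightarrow> 't \<Rightarrow> 't \<Rightarrow> (real \<Rightarrow> 't) \<Rightarrow> bool" where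
  "arc_path M d x y c \<longleftrightarrow>
     pathin (Metric_space.mtopology M d) c \<and> inj_on c {0..1} \<and> c 0 = x \<and> c 1 = y"

text \<open>A real tree is a nonempty geodesic metric space in which any two points are joined by at
  most one arc; arcs are identified with their images.\<close>

definition real_tree :: "'t set \<Rightarrow> ('t \<Rightarrow> 't \<Rightarrow> real) \<Rightarrow> bool" where
  "real_tree M d \<longleftrightarrow>
     Metric_space M d \<and> M \<noteq> {} \<and>
     (\<forall>x\<in>M. \<forall>y\<in>M. \<exists>c. geodesic_path M d x y c) \<and>
     (\<forall>x\<in>M. \<forall>y\<in>M. \<forall>b c. arc_path M d x y b \<and> arc_path M d x y c \<longrightarrow> b ` {0..1} = c ` {0..1})"


section \<open>Ultralimits and asymptotic cones\<close>

definition nonprincipal_ultrafilter :: "nat filter \<Rightarrow> bool" where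
  "nonprincipal_ultrafilter \<omega> \<longleftrightarrow>
     \<omega> \<noteq> bot \<and>
     (\<forall>P. eventually P \<omega> \<or> eventually (\<lambda>n. \<not> P n) \<omega>) \<and>
     (\<forall>m. \<not> eventually (\<lambda>n. n = m) \<omega>)"

definition ultralimit_seqs ::
  "nat filter \<Rightarrow> (nat \<Rightarrow> 'x set) \<Rightarrow> (nat \<Rightarrow> 'x \<Rightarrow> 'x \<Rightarrow> real) \<Rightarrow> (nat \<Rightarrow> 'x) \<Rightarrow> (nat \<Rightarrow> 'x) set" where
  "ultralimit_seqs \<omega> X D p =
     {x. (\<forall>n. x n \<in> X n) \<and> (\<exists>C. eventually (\<lambda>n. D n (x n) (p n) \<le> C) \<omega>)}"

definition ultralimit_rel ::
  "nat filter \<Rightarrow> (nat \<Rightarrow> 'x set) \<Rightarrow> (nat \<Rightarrow> 'x \<Rightarrow> 'x \<Rightarrow> real) \<Rightarrow> (nat \<Rightarrow> 'x)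
     \<Rightarrow> ((nat \<Rightarrow> 'x) \<times> (nat \<Rightarrow> 'x)) set" where
  "ultralimit_rel \<omega> X D p =
     {(x, y). x \<in> ultralimit_seqs \<omega> X D p \<and> y \<in> ultralimit_seqs \<omega> X D p \<and>
              ((\<lambda>n. D n (x n) (y n)) \<longlongrightarrow> 0) \<omega>}"

definition ultralimit ::
  "nat filter \<Rightarrow> (nat \<Rightarrow> 'x set) \<Rightarrow> (nat \<Rightarrow> 'x \<Rightarrow> 'x \<Rightarrow> real) \<Rightarrow> (nat \<Rightarrow> 'x) \<Rightarrow> (nat \<Rightarrow> 'x) set set" where
  "ultralimit \<omega> X D p = ultralimit_seqs \<omega> X D p // ultralimit_rel \<omega> X D p"

text \<open>The value \<open>0\<close> off the carrier is needed because \<^locale>\<open>Metric_space\<close> asks for symmetry and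
  nonnegativity of the distance on the whole type.\<close>

definition ultralimit_dist ::
  "nat filter \<Rightarrow> (nat \<Rightarrow> 'x set) \<Rightarrow> (nat \<Rightarrow> 'x \<Rightarrow> 'x \<Rightarrow> real) \<Rightarrow> (nat \<Rightarrow> 'x)
     \<Rightarrow> (nat \<Rightarrow> 'x) set \<Rightarrow> (nat \<Rightarrow> 'x) set \<Rightarrow> real" where
  "ultralimit_dist \<omega> X D p A B =
     (if A \<in> ultralimit \<omega> X D p \<and> B \<in> ultralimit \<omega> X D p
      then Lim \<omega> (\<lambda>n. D n ((SOME x. x \<in> A) n) ((SOME y. y \<in> B) n)) else 0)"

definition generating_set :: "('a, 'm) monoid_scheme \<Rightarrow> 'a set \<Rightarrow> bool" where
  "generating_set G S \<longleftrightarrow> S \<subseteq> carrier G \<and> generate G S = carrier G"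

definition word_length :: "('a, 'm) monoid_scheme \<Rightarrow> 'a set \<Rightarrow> 'a \<Rightarrow> nat" where
  "word_length G S g =
     (LEAST n. \<exists>w. set w \<subseteq> S \<union> (\<lambda>s. inv\<^bsub>G\<^esub> s) ` S \<and> length w = n \<and>
                   foldr (\<lambda>x y. x \<otimes>\<^bsub>G\<^esub> y) w \<one>\<^bsub>G\<^esub> = g)"

definition word_dist :: "('a, 'm) monoid_scheme \<Rightarrow> 'a set \<Rightarrow> 'a \<Rightarrow> 'a \<Rightarrow> real" where
  "word_dist G S g h = real (word_length G S (inv\<^bsub>G\<^esub> g \<otimes>\<^bsub>G\<^esub> h))"

definition asymptotic_cone ::
  "('a, 'm) monoid_scheme \<Rightarrow> 'a set \<Rightarrow> nat filter \<Rightarrow> (nat \<Rightarrow> real) \<Rightarrow> (nat \<Rightarrow> 'a) set set" where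
  "asymptotic_cone G S \<omega> r =
     ultralimit \<omega> (\<lambda>n. carrier G) (\<lambda>n g h. word_dist G S g h / r n) (\<lambda>n. \<one>\<^bsub>G\<^esub>)"

definition asymptotic_cone_dist ::
  "('a, 'm) monoid_scheme \<Rightarrow> 'a set \<Rightarrow> nat filter \<Rightarrow> (nat \<Rightarrow> real)
     \<Rightarrow> (nat \<Rightarrow> 'a) set \<Rightarrow> (nat \<Rightarrow> 'a) set \<Rightarrow> real" where
  "asymptotic_cone_dist G S \<omega> r =
     ultralimit_dist \<omega> (\<lambda>n. carrier G) (\<lambda>n g h. word_dist G S g h / r n) (\<lambda>n. \<one>\<^bsub>G\<^esub>)"

definition lacunary_hyperbolic :: "('a, 'm) monoid_scheme \<Rightarrow> bool" where
  "lacunary_hyperbolic G \<longleftrightarrow>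
     (\<exists>S \<omega> r. finite S \<and> generating_set G S \<and> nonprincipal_ultrafilter \<omega> \<and>
        (\<forall>n. 0 < r n) \<and> filterlim r at_top sequentially \<and>
        real_tree (asymptotic_cone G S \<omega> r) (asymptotic_cone_dist G S \<omega> r))"


section \<open>Property (FR) and the co-Hopf property\<close>

definition isometric_action ::
  "('a, 'm) monoid_scheme \<Rightarrow> 't set \<Rightarrow> ('t \<Rightarrow> 't \<Rightarrow> real) \<Rightarrow> ('a \<Rightarrow> 't \<Rightarrow> 't) \<Rightarrow> bool" where
  "isometric_action G M d \<phi> \<longleftrightarrow>
     group_action G M \<phi> \<and>
     (\<forall>g\<in>carrier G. \<forall>x\<in>M. \<forall>y\<in>M. d (\<phi> g x) (\<phi> g y) = d x y)"

definition FR_on_type :: "'t itself \<Rightarrow> ('a, 'm) monoid_scheme \<Rightarrow> bool" where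
  "FR_on_type _ G \<longleftrightarrow>
     (\<forall>(M :: 't set) d \<phi>. real_tree M d \<and> isometric_action G M d \<phi> \<longrightarrow>
        (\<exists>x\<in>M. \<forall>g\<in>carrier G. \<phi> g x = x))"

text \<open>A definition cannot quantify over all types, so the trees are taken with points in
  \<open>'a \<times> real\<close>. This is no restriction: \<open>property_FR_imp_FR_on_type\<close> below shows that it gives
  fixed points on real trees with points in any type, because the subtree spanned by an orbit
  can be copied into \<open>'a \<times> real\<close>.\<close>

definition property_FR :: "('a, 'm) monoid_scheme \<Rightarrow> bool" where
  "property_FR G \<longleftrightarrow> FR_on_type TYPE('a \<times> real) G"

definition co_Hopfian :: "('a, 'm) monoid_scheme \<Rightarrow> bool" where
  "co_Hopfian G \<longleftrightarrow> (\<forall>f\<in>hom G G. inj_on f (carrier G) \<longrightarrow> f \<in> iso G G)"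


section \<open>Asymptotic cones are nonempty metric spaces\<close>

lemma ultrafilter_bounded_convergent:
  fixes u :: "nat \<Rightarrow> real"
  assumes \<omega>: "nonprincipal_ultrafilter \<omega>" and bd: "eventually (\<lambda>n. \<bar>u n\<bar> \<le> C) \<omega>"
  shows "\<exists>l. (u \<longlongrightarrow> l) \<omega>"
proof -
  let ?F = "filtermap u \<omega>"
  have nb: "\<omega> \<noteq> bot" using \<omega> by (simp add: nonprincipal_ultrafilter_def)
  have "compact {- C..C}" by simp
  moreover have "?F \<noteq> bot" using nb by (simp add: filtermap_bot_iff)
  moreover have "eventually (\<lambda>x. x \<in> {- C..C}) ?F"
    unfolding eventually_filtermap by (rule eventually_mono[OF bd]) auto
  ultimately obtain l where l: "inf (nhds l) ?F \<noteq> bot"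
    unfolding compact_filter by meson
  have "(u \<longlongrightarrow> l) \<omega>"
    unfolding tendsto_def
  proof (intro allI impI)
    fix S :: "real set" assume S: "open S" "l \<in> S"
    show "eventually (\<lambda>n. u n \<in> S) \<omega>"
    proof (rule ccontr)
      assume "\<not> ?thesis"
      then have "eventually (\<lambda>n. u n \<notin> S) \<omega>"
        using \<omega> unfolding nonprincipal_ultrafilter_def by blast
      then have 1: "eventually (\<lambda>x. x \<notin> S) ?F" by (simp add: eventually_filtermap)
      have 2: "eventually (\<lambda>x. x \<in> S) (nhds l)" using S by (simp add: eventually_nhds_in_open)
      have "eventually (\<lambda>_. False) (inf (nhds l) ?F)"
        unfolding eventually_inf by (intro exI conjI, rule 2, rule 1) auto
      then show False using l by (simp add: trivial_limit_def)
    qed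
  qed
  then show ?thesis by blast
qed

lemma Metric_space_ultralimit:
  assumes \<omega>: "nonprincipal_ultrafilter \<omega>" and p: "\<And>n. p n \<in> X n"
    and nn: "\<And>n x y. \<lbrakk>x \<in> X n; y \<in> X n\<rbrakk> \<Longrightarrow> 0 \<le> D n x y"
    and sym: "\<And>n x y. \<lbrakk>x \<in> X n; y \<in> X n\<rbrakk> \<Longrightarrow> D n x y = D n y x"
    and refl: "\<And>n x. x \<in> X n \<Longrightarrow> D n x x = 0"
    and tri: "\<And>n x y z. \<lbrakk>x \<in> X n; y \<in> X n; z \<in> X n\<rbrakk> \<Longrightarrow> D n x z \<le> D n x y + D n y z"
  shows "Metric_space (ultralimit \<omega> X D p) (ultralimit_dist \<omega> X D p)" and "ultralimit \<omega> X D p \<noteq> {}"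
proof -
  have nb: "\<omega> \<noteq> bot" using \<omega> by (simp add: nonprincipal_ultrafilter_def)
  let ?Q = "ultralimit_seqs \<omega> X D p" and ?R = "ultralimit_rel \<omega> X D p"
  let ?U = "ultralimit \<omega> X D p" and ?d = "ultralimit_dist \<omega> X D p"
  have QX: "x n \<in> X n" if "x \<in> ?Q" for x n using that by (simp add: ultralimit_seqs_def)
  have conv: "((\<lambda>n. D n (x n) (y n)) \<longlongrightarrow> Lim \<omega> (\<lambda>n. D n (x n) (y n))) \<omega>"
    if x: "x \<in> ?Q" and y: "y \<in> ?Q" for x y
  proof -
    obtain B C where "eventually (\<lambda>n. D n (x n) (p n) \<le> B) \<omega>" "eventually (\<lambda>n. D n (y n) (p n) \<le> C) \<omega>"
      using x y by (auto simp: ultralimit_seqs_def)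
    then have "eventually (\<lambda>n. \<bar>D n (x n) (y n)\<bar> \<le> B + C) \<omega>"
    proof eventually_elim
      case (elim n)
      have "D n (x n) (y n) \<le> D n (x n) (p n) + D n (p n) (y n)" by (intro tri QX x y p)
      then show ?case using elim sym[OF QX[OF y] p, of n] nn[OF QX[OF x] QX[OF y], of n] by simp
    qed
    from ultrafilter_bounded_convergent[OF \<omega> this] obtain l
      where l: "((\<lambda>n. D n (x n) (y n)) \<longlongrightarrow> l) \<omega>" ..
    then show ?thesis using tendsto_Lim[OF nb l] by simp
  qed
  let ?r = "\<lambda>A. SOME x. x \<in> A"
  have RD: "(x, y) \<in> ?R \<longleftrightarrow> x \<in> ?Q \<and> y \<in> ?Q \<and> Lim \<omega> (\<lambda>n. D n (x n) (y n)) = 0" for x y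
    using conv[of x y] tendsto_Lim[OF nb, of "\<lambda>n. D n (x n) (y n)" 0] by (auto simp: ultralimit_rel_def)
  have L0: "0 \<le> Lim \<omega> (\<lambda>n. D n (x n) (y n))" if "x \<in> ?Q" "y \<in> ?Q" for x y
    by (rule tendsto_lowerbound[OF conv[OF that] _ nb]) (simp add: nn QX that)
  have Ltri: "Lim \<omega> (\<lambda>n. D n (x n) (z n)) \<le> Lim \<omega> (\<lambda>n. D n (x n) (y n)) + Lim \<omega> (\<lambda>n. D n (y n) (z n))"
    if "x \<in> ?Q" "y \<in> ?Q" "z \<in> ?Q" for x y z
    by (rule tendsto_le[OF nb tendsto_add[OF conv[OF that(1,2)] conv[OF that(2,3)]] conv[OF that(1,3)]])
       (simp add: tri QX that)
  have Lsym: "Lim \<omega> (\<lambda>n. D n (x n) (y n)) = Lim \<omega> (\<lambda>n. D n (y n) (x n))" if "x \<in> ?Q" "y \<in> ?Q" for x y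
    using sym[OF QX[OF that(1)] QX[OF that(2)]] by simp
  have Lrefl: "Lim \<omega> (\<lambda>n. D n (x n) (x n)) = 0" if "x \<in> ?Q" for x
    using refl[OF QX[OF that]] nb by (simp add: tendsto_Lim)
  have eq: "equiv ?Q ?R"
  proof (rule equivI)
    show "?R \<subseteq> ?Q \<times> ?Q" by (auto simp: RD)
    show "refl_on ?Q ?R" by (auto simp: refl_on_def RD Lrefl)
    show "Relation.sym ?R" unfolding Relation.sym_def RD using Lsym by metis
    show "trans ?R"
    proof (rule transI)
      fix x y z assume "(x, y) \<in> ?R" "(y, z) \<in> ?R"
      then show "(x, z) \<in> ?R" using Ltri[of x y z] L0[of x z] by (auto simp: RD)
    qed
  qed
  have rep: "?r A \<in> ?Q" "A = ?R `` {?r A}" if A: "A \<in> ?U" for A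
  proof -
    obtain x where x: "x \<in> ?Q" "A = ?R `` {x}" using A unfolding ultralimit_def by (elim quotientE) blast
    then have "x \<in> A" using equiv_class_self[OF eq] by simp
    then have r: "?r A \<in> A" by (rule someI[where P = "\<lambda>x. x \<in> A"])
    then have "(x, ?r A) \<in> ?R" using x(2) by blast
    then show "?r A \<in> ?Q" by (simp add: RD)
    show "A = ?R `` {?r A}" using equiv_class_eq[OF eq \<open>(x, ?r A) \<in> ?R\<close>] x(2) by argo
  qed
  have dd: "?d A B = Lim \<omega> (\<lambda>n. D n (?r A n) (?r B n))" if "A \<in> ?U" "B \<in> ?U" for A B
    using that by (simp add: ultralimit_dist_def)
  show "Metric_space ?U ?d"
  proof
    fix A B
    show "0 \<le> ?d A B" using L0[OF rep(1)[of A] rep(1)[of B]] by (simp add: ultralimit_dist_def)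
    show "?d A B = ?d B A" using Lsym[OF rep(1)[of A] rep(1)[of B]] by (simp add: ultralimit_dist_def)
  next
    fix A B assume AB: "A \<in> ?U" "B \<in> ?U"
    have "?d A B = 0 \<longleftrightarrow> (?r A, ?r B) \<in> ?R" using rep(1) AB by (simp add: RD dd)
    also have "\<dots> \<longleftrightarrow> A = B"
      using eq_equiv_class_iff[OF eq rep(1)[OF AB(1)] rep(1)[OF AB(2)]] rep(2)[OF AB(1)] rep(2)[OF AB(2)] by metis
    finally show "?d A B = 0 \<longleftrightarrow> A = B" .
  next
    fix A B C assume "A \<in> ?U" "B \<in> ?U" "C \<in> ?U"
    then show "?d A C \<le> ?d A B + ?d B C" using Ltri[OF rep(1)[of A] rep(1)[of B] rep(1)[of C]] by (simp add: dd)
  qed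
  have "p \<in> ?Q" using p refl by (auto simp: ultralimit_seqs_def intro!: exI[of _ 0])
  then show "?U \<noteq> {}" unfolding ultralimit_def by (auto simp: quotient_def)
qed

context group
begin

lemma foldr_mult_closed: "set w \<subseteq> carrier G \<Longrightarrow> foldr (\<lambda>x y. x \<otimes> y) w \<one> \<in> carrier G"
  by (induction w) auto

lemma foldr_mult_append:
  "\<lbrakk>set v \<subseteq> carrier G; set w \<subseteq> carrier G\<rbrakk> \<Longrightarrow>
     foldr (\<lambda>x y. x \<otimes> y) (v @ w) \<one> = foldr (\<lambda>x y. x \<otimes> y) v \<one> \<otimes> foldr (\<lambda>x y. x \<otimes> y) w \<one>"
proof (induction v)
  case Nil then show ?case using foldr_mult_closed[of w] by simp
next
  case (Cons a v) then show ?case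
    using foldr_mult_closed[of w] foldr_mult_closed[of v] by (simp add: m_assoc)
qed

lemma foldr_mult_inv:
  "set w \<subseteq> carrier G \<Longrightarrow> foldr (\<lambda>x y. x \<otimes> y) (rev (map (\<lambda>x. inv x) w)) \<one> = inv (foldr (\<lambda>x y. x \<otimes> y) w \<one>)"
proof (induction w)
  case (Cons a w)
  have "set (rev (map (\<lambda>x. inv x) w)) \<subseteq> carrier G" "set [inv a] \<subseteq> carrier G" using Cons.prems by auto
  from foldr_mult_append[OF this] show ?case
    using Cons foldr_mult_closed[of w] by (simp add: inv_mult_group)
qed simp

context
  fixes S assumes S: "generating_set G S"
begin

private abbreviation "L \<equiv> S \<union> (\<lambda>s. inv s) ` S"

private lemma LG: "set w \<subseteq> L \<Longrightarrow> set w \<subseteq> carrier G"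
  using S by (force simp: generating_set_def)

lemma word_exists:
  assumes "g \<in> carrier G"
  shows "\<exists>w. set w \<subseteq> L \<and> foldr (\<lambda>x y. x \<otimes> y) w \<one> = g"
proof -
  have SG: "S \<subseteq> carrier G" using S by (simp add: generating_set_def)
  have "g \<in> generate G S" using S assms by (simp add: generating_set_def)
  then show ?thesis
  proof induction
    case one show ?case by (intro exI[of _ "[]"]) simp
  next
    case (incl h) then show ?case using SG by (intro exI[of _ "[h]"]) auto
  next
    case (inv h) then show ?case using SG by (intro exI[of _ "[inv h]"]) auto
  next
    case (eng g h)
    then obtain v w where "set v \<subseteq> L" "foldr (\<lambda>x y. x \<otimes> y) v \<one> = g" "set w \<subseteq> L" "foldr (\<lambda>x y. x \<otimes> y) w \<one> = h"
      by blast
    then show ?case using foldr_mult_append[OF LG LG, of v w] by (intro exI[of _ "v @ w"]) simp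
  qed
qed

lemma word_length_witness:
  assumes "g \<in> carrier G"
  obtains w where "set w \<subseteq> L" "length w = word_length G S g" "foldr (\<lambda>x y. x \<otimes> y) w \<one> = g"
proof -
  have "\<exists>n w. set w \<subseteq> L \<and> length w = n \<and> foldr (\<lambda>x y. x \<otimes> y) w \<one> = g"
    using word_exists[OF assms] by blast
  from LeastI_ex[OF this] show ?thesis using that unfolding word_length_def by blast
qed

lemma word_length_le: "set w \<subseteq> L \<Longrightarrow> word_length G S (foldr (\<lambda>x y. x \<otimes> y) w \<one>) \<le> length w"
  unfolding word_length_def by (rule Least_le) blast

lemma word_length_one: "word_length G S \<one> = 0"
  using word_length_le[of "[]"] by simp

lemma word_length_mult:
  assumes "g \<in> carrier G" "h \<in> carrier G"
  shows "word_length G S (g \<otimes> h) \<le> word_length G S g + word_length G S h"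
proof -
  obtain v w where "set v \<subseteq> L" "length v = word_length G S g" "foldr (\<lambda>x y. x \<otimes> y) v \<one> = g"
     "set w \<subseteq> L" "length w = word_length G S h" "foldr (\<lambda>x y. x \<otimes> y) w \<one> = h"
    using word_length_witness assms by metis
  then show ?thesis using word_length_le[of "v @ w"] foldr_mult_append[OF LG LG, of v w] by simp
qed

lemma word_length_inv_le:
  assumes "g \<in> carrier G" shows "word_length G S (inv g) \<le> word_length G S g"
proof -
  obtain w where w: "set w \<subseteq> L" "length w = word_length G S g" "foldr (\<lambda>x y. x \<otimes> y) w \<one> = g"
    using word_length_witness[OF assms] by blast
  have "inv x \<in> L" if "x \<in> L" for x
    using that S by (auto simp: generating_set_def subset_iff)
  then have "set (rev (map (\<lambda>x. inv x) w)) \<subseteq> L" using w(1) unfolding set_rev set_map by (intro image_subsetI) (meson subsetD)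
  from word_length_le[OF this] show ?thesis using foldr_mult_inv[OF LG[OF w(1)]] w by simp
qed

lemma word_length_inv: "g \<in> carrier G \<Longrightarrow> word_length G S (inv g) = word_length G S g"
  using word_length_inv_le[of g] word_length_inv_le[of "inv g"] by simp

lemma Metric_space_asymptotic_cone:
  assumes \<omega>: "nonprincipal_ultrafilter \<omega>" and r: "\<And>n. 0 < r n"
  shows "Metric_space (asymptotic_cone G S \<omega> r) (asymptotic_cone_dist G S \<omega> r)"
    and "asymptotic_cone G S \<omega> r \<noteq> {}"
proof -
  have nn: "0 \<le> word_dist G S x y / r n" for n x y using r[of n] by (simp add: word_dist_def)
  have sym: "word_dist G S x y / r n = word_dist G S y x / r n" if "x \<in> carrier G" "y \<in> carrier G" for n x y
    using that word_length_inv[of "inv x \<otimes> y"] by (simp add: word_dist_def inv_mult_group)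
  have refl: "word_dist G S x x / r n = 0" if "x \<in> carrier G" for n x
    using that by (simp add: word_dist_def word_length_one)
  have tri: "word_dist G S x z / r n \<le> word_dist G S x y / r n + word_dist G S y z / r n"
    if "x \<in> carrier G" "y \<in> carrier G" "z \<in> carrier G" for n x y z
  proof -
    have "y \<otimes> (inv y \<otimes> z) = z" using that by (simp flip: m_assoc)
    then have "(inv x \<otimes> y) \<otimes> (inv y \<otimes> z) = inv x \<otimes> z" using that by (simp add: m_assoc)
    then have "word_dist G S x z \<le> word_dist G S x y + word_dist G S y z"
      using word_length_mult[of "inv x \<otimes> y" "inv y \<otimes> z"] that by (simp add: word_dist_def flip: of_nat_add)
    then show ?thesis using r[of n] by (simp add: divide_right_mono flip: add_divide_distrib)
  qed
  show "Metric_space (asymptotic_cone G S \<omega> r) (asymptotic_cone_dist G S \<omega> r)"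
     "asymptotic_cone G S \<omega> r \<noteq> {}"
    unfolding asymptotic_cone_def asymptotic_cone_dist_def
    by (intro Metric_space_ultralimit[OF \<omega>] nn sym refl tri one_closed; assumption)+
qed

end

end


section \<open>Independence of the type of points of the trees\<close>

lemma real_tree_metric: "real_tree M d \<Longrightarrow> Metric_space M d"
  by (simp add: real_tree_def)

lemma real_tree_geodesic:
  assumes "real_tree M d" "x \<in> M" "y \<in> M"
  obtains c where "geodesic_path M d x y c"
  using assms unfolding real_tree_def by meson

lemma continuous_map_dist_le:
  fixes K :: real
  assumes "Metric_space M d" and "Metric_space M' d'"
    and "f \<in> M \<rightarrow> M'" and le: "\<And>x y. \<lbrakk>x \<in> M; y \<in> M\<rbrakk> \<Longrightarrow> d' (f x) (f y) \<le> K * d x y"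
  shows "continuous_map (Metric_space.mtopology M d) (Metric_space.mtopology M' d') f"
proof -
  interpret A: Metric_space M d by fact
  interpret B: Metric_space M' d' by fact
  show ?thesis
    unfolding A.metric_continuous_map[OF assms(2)]
  proof (intro conjI ballI allI impI)
    show "f ` M \<subseteq> M'" using assms(3) by auto
    fix a and e :: real assume a: "a \<in> M" and "0 < e"
    show "\<exists>\<delta>>0. \<forall>x. x \<in> M \<and> d a x < \<delta> \<longrightarrow> d' (f a) (f x) < e"
    proof (intro exI[of _ "e / (\<bar>K\<bar> + 1)"] conjI allI impI)
      show "0 < e / (\<bar>K\<bar> + 1)" using \<open>0 < e\<close> by simp
      fix x assume x: "x \<in> M \<and> d a x < e / (\<bar>K\<bar> + 1)"
      have "d' (f a) (f x) \<le> K * d a x" using le a x by blast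
      also have "\<dots> \<le> (\<bar>K\<bar> + 1) * d a x" by (intro mult_right_mono) auto
      also have "\<dots> < e" using x by (simp add: field_simps)
      finally show "d' (f a) (f x) < e" .
    qed
  qed
qed

lemma pathin_dist_le:
  fixes K :: real
  assumes "Metric_space M d" and "c \<in> {0..1} \<rightarrow> M"
    and "\<And>s t. \<lbrakk>s \<in> {0..1}; t \<in> {0..1}\<rbrakk> \<Longrightarrow> d (c s) (c t) \<le> K * \<bar>s - t\<bar>"
  shows "pathin (Metric_space.mtopology M d) c"
proof -
  have "Metric_space {0..1::real} dist"
    by (rule Met_TC.subspace) auto
  moreover have "Metric_space.mtopology {0..1::real} dist = subtopology euclideanreal {0..1}"
    using Submetric.mtopology_submetric[of UNIV dist "{0..1::real}"]
    by (simp add: Met_TC.Metric_space_axioms Submetric.intro Submetric_axioms.intro)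
  ultimately show ?thesis
    unfolding pathin_def
    using continuous_map_dist_le[OF _ assms(1,2), of dist K] assms(3) by (simp add: dist_real_def)
qed

text \<open>A 1-Lipschitz injective map on a compact interval gives an arc.\<close>

lemma arc_path_rescale:
  assumes "Metric_space M d" and "0 < L" and c: "c \<in> {0..L} \<rightarrow> M" and inj: "inj_on c {0..L}"
    and le: "\<And>s t. \<lbrakk>s \<in> {0..L}; t \<in> {0..L}\<rbrakk> \<Longrightarrow> d (c s) (c t) \<le> \<bar>s - t\<bar>"
  shows "arc_path M d (c 0) (c L) (\<lambda>t. c (L * t))" and "(\<lambda>t. c (L * t)) ` {0..1} = c ` {0..L}"
proof -
  have m: "L * t \<in> {0..L}" if "t \<in> {0..1}" for t
    using that \<open>0 < L\<close> by (auto simp: mult_le_cancel_left1)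
  have im: "(\<lambda>t. L * t) ` {0..1} = {0..L}"
    using \<open>0 < L\<close> by (simp add: image_mult_atLeastAtMost)
  show "(\<lambda>t. c (L * t)) ` {0..1} = c ` {0..L}"
    by (metis im image_image)
  have "pathin (Metric_space.mtopology M d) (\<lambda>t. c (L * t))"
  proof (rule pathin_dist_le[where K = L])
    show "(\<lambda>t. c (L * t)) \<in> {0..1} \<rightarrow> M" using m c by blast
    fix s t :: real assume "s \<in> {0..1}" "t \<in> {0..1}"
    then have "d (c (L * s)) (c (L * t)) \<le> \<bar>L * s - L * t\<bar>" using m le by blast
    also have "\<dots> = L * \<bar>s - t\<bar>"
      using \<open>0 < L\<close> by (simp add: abs_mult flip: right_diff_distrib)
    finally show "d (c (L * s)) (c (L * t)) \<le> L * \<bar>s - t\<bar>" .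
  qed fact
  moreover have "inj_on (\<lambda>t. c (L * t)) {0..1}"
  proof (rule inj_onI)
    fix s t :: real assume "s \<in> {0..1}" "t \<in> {0..1}" "c (L * s) = c (L * t)"
    then have "L * s = L * t" using inj m by (meson inj_onD)
    then show "s = t" using \<open>0 < L\<close> by simp
  qed
  ultimately show "arc_path M d (c 0) (c L) (\<lambda>t. c (L * t))"
    by (simp add: arc_path_def)
qed

lemma geodesic_path_inj:
  assumes "geodesic_path M d x y c" "Metric_space M d"
  shows "inj_on c {0..d x y}"
proof (rule inj_onI)
  fix s t assume st: "s \<in> {0..d x y}" "t \<in> {0..d x y}" "c s = c t"
  have "c t \<in> M" using assms(1) st by (auto simp: geodesic_path_def)
  then have "d (c s) (c t) = 0" using st assms(2) by (simp add: Metric_space.zero)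
  moreover have "d (c s) (c t) = \<bar>s - t\<bar>" using assms(1) st(1,2) unfolding geodesic_path_def by blast
  ultimately show "s = t" by simp
qed

text \<open>In a real tree, a geodesic has the same image as any 1-Lipschitz injective path between its
  endpoints.\<close>

lemma geodesic_path_image_eq:
  assumes T: "real_tree M d" and g: "geodesic_path M d x y c" and "x \<in> M" "y \<in> M" "0 \<le> L"
    and e: "e \<in> {0..L} \<rightarrow> M" "inj_on e {0..L}" "e 0 = x" "e L = y"
    and le: "\<And>s t. \<lbrakk>s \<in> {0..L}; t \<in> {0..L}\<rbrakk> \<Longrightarrow> d (e s) (e t) \<le> \<bar>s - t\<bar>"
  shows "c ` {0..d x y} = e ` {0..L}"
proof -
  interpret Metric_space M d using T by (rule real_tree_metric)
  show ?thesis
  proof (cases "x = y")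
    case True
    have "L = 0" using e(2,3,4) True \<open>0 \<le> L\<close> by (auto dest: inj_onD)
    then show ?thesis using True g e \<open>y \<in> M\<close> by (simp add: geodesic_path_def)
  next
    case False
    have "0 < d x y" using False \<open>x \<in> M\<close> \<open>y \<in> M\<close> by simp
    have "0 < L" using False e \<open>0 \<le> L\<close> by (cases "L = 0") auto
    have cc: "c \<in> {0..d x y} \<rightarrow> M" "c 0 = x" "c (d x y) = y" 
      "\<And>s t. \<lbrakk>s \<in> {0..d x y}; t \<in> {0..d x y}\<rbrakk> \<Longrightarrow> d (c s) (c t) \<le> \<bar>s - t\<bar>"
      using g by (auto simp: geodesic_path_def)
    note 1 = arc_path_rescale[OF Metric_space_axioms \<open>0 < d x y\<close> cc(1) geodesic_path_inj[OF g Metric_space_axioms] cc(4)]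
    note 2 = arc_path_rescale[OF Metric_space_axioms \<open>0 < L\<close> e(1,2) le]
    have "(\<lambda>t. c (d x y * t)) ` {0..1} = (\<lambda>t. e (L * t)) ` {0..1}"
      using T 1(1) 2(1) cc e \<open>x \<in> M\<close> \<open>y \<in> M\<close> unfolding real_tree_def by metis
    then show ?thesis using 1(2) 2(2) by simp
  qed
qed

text \<open>Geodesic triangles in a real tree are tripods.\<close>

lemma real_tree_thin:
  assumes T: "real_tree M d" and M: "x \<in> M" "y \<in> M" "z \<in> M"
    and a: "geodesic_path M d x y a" and b: "geodesic_path M d x z b" and c: "geodesic_path M d y z c"
  shows "c ` {0..d y z} \<subseteq> a ` {0..d x y} \<union> b ` {0..d x z}"
proof -
  interpret Metric_space M d using T by (rule real_tree_metric)
  let ?A = "d x y" and ?B = "d x z"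
  have aM: "a s \<in> M" if "s \<in> {0..?A}" for s using a that by (auto simp: geodesic_path_def)
  have bM: "b s \<in> M" if "s \<in> {0..?B}" for s using b that by (auto simp: geodesic_path_def)
  have ad: "d (a s) (a t) = \<bar>s - t\<bar>" if "s \<in> {0..?A}" "t \<in> {0..?A}" for s t
    using a that by (auto simp: geodesic_path_def)
  have bd: "d (b s) (b t) = \<bar>s - t\<bar>" if "s \<in> {0..?B}" "t \<in> {0..?B}" for s t
    using b that by (auto simp: geodesic_path_def)
  have a0: "a 0 = x" "a ?A = y" and b0: "b 0 = x" "b ?B = z"
    using a b by (auto simp: geodesic_path_def)
  define m where "m = min ?A ?B"
  define P where "P = {t \<in> {0..m}. a t = b t}"
  define p where "p = Sup P"
  have m0: "0 \<le> m" by (simp add: m_def)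
  have "0 \<in> P" using m0 a0 b0 by (simp add: P_def)
  have bdd: "bdd_above P" by (rule bdd_aboveI[of _ m]) (auto simp: P_def)
  have pm: "p \<in> {0..m}"
    using \<open>0 \<in> P\<close> bdd unfolding p_def
    by (auto intro: cSup_upper intro!: cSup_least simp: P_def)
  have pA: "p \<in> {0..?A}" and pB: "p \<in> {0..?B}" using pm by (auto simp: m_def)
  have pP: "a p = b p"
  proof -
    have "d (a p) (b p) \<le> e" if "0 < e" for e :: real
    proof -
      obtain t where t: "t \<in> P" "p - e / 2 < t"
        using less_cSupE[of "p - e / 2" P] \<open>0 \<in> P\<close> \<open>0 < e\<close> unfolding p_def by force
      have tp: "t \<le> p" using t bdd by (simp add: p_def cSup_upper)
      have tA: "t \<in> {0..?A}" and tB: "t \<in> {0..?B}" and ab: "a t = b t" using t by (auto simp: P_def m_def)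
      have "d (a p) (b p) \<le> d (a p) (a t) + d (b t) (b p)"
        using triangle[OF aM[OF pA] aM[OF tA] bM[OF pB]] by (simp only: ab)
      also have "\<dots> = 2 * (p - t)" using ad[OF pA tA] bd[OF tB pB] tp by simp
      also have "\<dots> \<le> e" using t(2) by (simp add: field_simps)
      finally show ?thesis .
    qed
    then have "d (a p) (b p) \<le> 0" using field_le_epsilon[of "d (a p) (b p)" 0] by simp
    then show ?thesis using zero[OF aM[OF pA] bM[OF pB]] nonneg[of "a p" "b p"] by linarith
  qed
  have dx: "d x (a s) = s" if "s \<in> {0..?A}" for s using ad[of 0 s] that a0 by auto
  have dx': "d x (b s) = s" if "s \<in> {0..?B}" for s using bd[of 0 s] that b0 by auto
  define L where "L = (?A - p) + (?B - p)"
  define e where "e u = (if u \<le> ?A - p then a (?A - u) else b (u - (?A - p) + p))" for u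
  have "0 \<le> L" using pA pB by (simp add: L_def)
  have r1: "?A - u \<in> {p..?A}" if "u \<in> {0..L}" "u \<le> ?A - p" for u
    using that pA by auto
  have r2: "u - (?A - p) + p \<in> {p<..?B}" if "u \<in> {0..L}" "\<not> u \<le> ?A - p" for u
    using that pA by (auto simp: L_def)
  have sub: "{p..?A} \<subseteq> {0..?A}" "{p<..?B} \<subseteq> {0..?B}" using pA pB by auto
  have eM: "e \<in> {0..L} \<rightarrow> M"
    using r1 r2 sub aM bM by (auto simp: e_def subset_iff simp del: atLeastAtMost_iff greaterThanAtMost_iff)
  have cross: "a s \<noteq> b t" if "s \<in> {p..?A}" "t \<in> {p<..?B}" for s t
  proof
    assume eq: "a s = b t"
    have "s = t" using dx[of s] dx'[of t] that sub eq by auto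
    then have "t \<in> P" using that eq pA by (auto simp: P_def m_def)
    then have "t \<le> p" using bdd by (simp add: p_def cSup_upper)
    then show False using that by simp
  qed
  have einj: "inj_on e {0..L}"
  proof (rule inj_onI)
    fix u v assume uv: "u \<in> {0..L}" "v \<in> {0..L}" and eq: "e u = e v"
    note ai = inj_onD[OF geodesic_path_inj[OF a Metric_space_axioms]]
    note bi = inj_onD[OF geodesic_path_inj[OF b Metric_space_axioms]]
    consider "u \<le> ?A - p" "v \<le> ?A - p" | "u \<le> ?A - p" "\<not> v \<le> ?A - p"
      | "\<not> u \<le> ?A - p" "v \<le> ?A - p" | "\<not> u \<le> ?A - p" "\<not> v \<le> ?A - p" by blast
    then show "u = v"
    proof cases
      case 1 then show ?thesis using ai[of "?A - u" "?A - v"] eq r1[of u] r1[of v] uv sub by (auto simp: e_def)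
    next
      case 2 then show ?thesis using cross[OF r1[of u] r2[of v]] uv eq by (simp add: e_def)
    next
      case 3 then show ?thesis using cross[OF r1[of v] r2[of u]] uv eq[symmetric] by (simp add: e_def)
    next
      case 4
      then have "u - (?A - p) + p = v - (?A - p) + p"
        using eq uv by (intro bi) (use r2[of u] r2[of v] pA in \<open>auto simp: e_def\<close>)
      then show ?thesis by simp
    qed
  qed
  have le1: "d (e u) (e v) \<le> v - u" if uv: "u \<in> {0..L}" "v \<in> {0..L}" "u \<le> v" for u v
  proof -
    consider "v \<le> ?A - p" | "u \<le> ?A - p" "\<not> v \<le> ?A - p" | "\<not> u \<le> ?A - p" using uv by linarith
    then show ?thesis
    proof cases
      case 1
      then show ?thesis using ad[of "?A - u" "?A - v"] r1[of u] r1[of v] uv sub by (auto simp: e_def)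
    next
      case 2
      let ?w = "v - (?A - p) + p"
      have s: "?A - u \<in> {0..?A}" and w: "?w \<in> {0..?B}" and w': "?w > p"
        using r1[of u] r2[of v] 2 uv sub by (auto simp: subset_iff)
      have "d (e u) (e v) = d (a (?A - u)) (b ?w)" using 2 by (simp add: e_def)
      also have "\<dots> \<le> d (a (?A - u)) (a p) + d (b p) (b ?w)"
        using triangle[OF aM[OF s] aM[OF pA] bM[OF w]] by (simp only: pP)
      also have "\<dots> = v - u" using ad[OF s pA] bd[OF pB w] 2 w' by simp
      finally show ?thesis by simp
    next
      case 3
      then have v: "\<not> v \<le> ?A - p" using uv by simp
      have "u - (?A - p) + p \<in> {0..?B}" "v - (?A - p) + p \<in> {0..?B}"
        using r2[of u] r2[of v] 3 v uv sub by blast+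
      from bd[OF this] show ?thesis using 3 v uv by (simp add: e_def)
    qed
  qed
  have le: "d (e u) (e v) \<le> \<bar>u - v\<bar>" if "u \<in> {0..L}" "v \<in> {0..L}" for u v
    using le1[of u v] le1[of v u] that by (cases "u \<le> v") (simp_all add: commute[of "e u" "e v"])
  have e0: "e 0 = y" using pA a0 by (simp add: e_def)
  have eL: "e L = z"
  proof (cases "p = ?B")
    case True then show ?thesis using pP b0 by (simp add: e_def L_def)
  next
    case False then show ?thesis using pB b0 by (simp add: e_def L_def)
  qed
  have "c ` {0..d y z} = e ` {0..L}"
    by (rule geodesic_path_image_eq[OF T c M(2,3) \<open>0 \<le> L\<close> eM einj e0 eL le])
  also have "\<dots> \<subseteq> a ` {0..?A} \<union> b ` {0..?B}"
  proof (rule image_subsetI)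
    fix u assume "u \<in> {0..L}"
    then show "e u \<in> a ` {0..?A} \<union> b ` {0..?B}"
      using r1[of u] r2[of u] sub by (cases "u \<le> ?A - p") (auto simp: e_def subset_iff)
  qed
  finally show ?thesis .
qed

lemma real_tree_convex_subset:
  assumes T: "real_tree M d" and "Y \<subseteq> M" "Y \<noteq> {}"
    and conv: "\<And>x y c. \<lbrakk>x \<in> Y; y \<in> Y; geodesic_path M d x y c\<rbrakk> \<Longrightarrow> c ` {0..d x y} \<subseteq> Y"
  shows "real_tree Y d"
proof -
  interpret Metric_space M d using T by (rule real_tree_metric)
  interpret Submetric M d Y by (simp add: Metric_space_axioms Submetric.intro Submetric_axioms.intro \<open>Y \<subseteq> M\<close>)
  have "\<exists>c. geodesic_path Y d x y c" if xy: "x \<in> Y" "y \<in> Y" for x y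
  proof -
    obtain c where "geodesic_path M d x y c"
      using real_tree_geodesic[OF T] xy \<open>Y \<subseteq> M\<close> by blast
    moreover from conv[OF xy this] have "c \<in> {0..d x y} \<rightarrow> Y" by auto
    ultimately show ?thesis by (auto simp: geodesic_path_def)
  qed
  moreover have "arc_path M d x y c" if "arc_path Y d x y c" for x y c
    using that by (auto simp: arc_path_def mtopology_submetric pathin_subtopology)
  ultimately show ?thesis
    using T \<open>Y \<subseteq> M\<close> \<open>Y \<noteq> {}\<close> sub.Metric_space_axioms unfolding real_tree_def by (meson subset_iff)
qed

lemma real_tree_transfer:
  assumes T: "real_tree Y d" and inj: "inj_on f Y"
  defines "d' \<equiv> \<lambda>p q. d (inv_into Y f p) (inv_into Y f q)"
  shows "real_tree (f ` Y) d'"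
proof -
  interpret Metric_space Y d using T by (rule real_tree_metric)
  let ?h = "inv_into Y f"
  have hf: "?h (f y) = y" if "y \<in> Y" for y using inj that by simp
  interpret B: Metric_space "f ` Y" d'
  proof
    show "0 \<le> d' x y" "d' x y = d' y x" for x y by (simp_all add: d'_def commute)
    show "d' x y = 0 \<longleftrightarrow> x = y" if "x \<in> f ` Y" "y \<in> f ` Y" for x y
      using that by (auto simp: d'_def hf)
    show "d' x z \<le> d' x y + d' y z" if "x \<in> f ` Y" "y \<in> f ` Y" "z \<in> f ` Y" for x y z
      using that by (auto simp: d'_def hf triangle)
  qed
  have ch: "continuous_map B.mtopology mtopology ?h"
    by (rule continuous_map_dist_le[where K = 1, OF B.Metric_space_axioms Metric_space_axioms])
       (auto simp: hf d'_def)
  have inv: "arc_path Y d (?h p) (?h q) (?h \<circ> c)" if c: "arc_path (f ` Y) d' p q c" for p q c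
  proof -
    have cim: "c ` {0..1} \<subseteq> f ` Y"
      using c path_image_subset_topspace[of B.mtopology c] by (auto simp: arc_path_def)
    have "inj_on ?h (c ` {0..1})"
      using inj_on_inv_into[of "c ` {0..1}" f Y] cim by simp
    then show ?thesis
      using c ch by (auto simp: arc_path_def comp_inj_on intro: pathin_compose)
  qed
  have "b ` {0..1} = c ` {0..1}" if bc: "arc_path (f ` Y) d' p q b" "arc_path (f ` Y) d' p q c"
    and pq: "p \<in> f ` Y" "q \<in> f ` Y" for p q b c
  proof -
    have "(?h \<circ> b) ` {0..1} = (?h \<circ> c) ` {0..1}"
      using T inv[OF bc(1)] inv[OF bc(2)] pq unfolding real_tree_def by (metis inv_into_into)
    then have "f ` ?h ` b ` {0..1} = f ` ?h ` c ` {0..1}" by (simp add: image_comp)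
    moreover have "b ` {0..1} \<subseteq> f ` Y" "c ` {0..1} \<subseteq> f ` Y"
      using bc path_image_subset_topspace[of B.mtopology] by (auto simp: arc_path_def)
    ultimately show ?thesis by (simp add: image_inv_into_cancel)
  qed
  moreover have "\<exists>c. geodesic_path (f ` Y) d' p q c" if pq: "p \<in> f ` Y" "q \<in> f ` Y" for p q
  proof -
    obtain c where c: "geodesic_path Y d (?h p) (?h q) c"
      using T pq by (meson real_tree_def inv_into_into)
    then have "geodesic_path (f ` Y) d' p q (f \<circ> c)"
      using pq by (auto simp: geodesic_path_def d'_def f_inv_into_f hf Pi_iff)
    then show ?thesis by blast
  qed
  moreover have "f ` Y \<noteq> {}" using T by (simp add: real_tree_def)
  ultimately show ?thesis
    unfolding real_tree_def using B.Metric_space_axioms by meson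
qed

theorem property_FR_imp_FR_on_type:
  assumes "property_FR G"
  shows "FR_on_type TYPE('t) G"
  unfolding FR_on_type_def
proof (intro allI impI, elim conjE)
  fix M :: "'t set" and d \<phi> assume T: "real_tree M d" and act: "isometric_action G M d \<phi>"
  interpret Metric_space M d using T by (rule real_tree_metric)
  interpret group_action G M \<phi> using act by (simp add: isometric_action_def)
  interpret G: group G using group_hom by (rule group_hom.axioms(1))
  have iso: "d (\<phi> g x) (\<phi> g y) = d x y" if "g \<in> carrier G" "x \<in> M" "y \<in> M" for g x y
    using act that by (simp add: isometric_action_def)
  have cl: "\<phi> g x \<in> M" if "g \<in> carrier G" "x \<in> M" for g x
    using element_image[OF that refl] .
  obtain x0 where x0: "x0 \<in> M" using T unfolding real_tree_def by blast
  define c where "c g = (SOME c. geodesic_path M d x0 (\<phi> g x0) c)" for g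
  have c: "geodesic_path M d x0 (\<phi> g x0) (c g)" if g: "g \<in> carrier G" for g
  proof -
    obtain b where "geodesic_path M d x0 (\<phi> g x0) b" using real_tree_geodesic[OF T x0 cl[OF g x0]] .
    then show ?thesis unfolding c_def by (rule someI[where P = "geodesic_path M d x0 (\<phi> g x0)"])
  qed
  define I where "I g = c g ` {0..d x0 (\<phi> g x0)}" for g
  define Y where "Y = (\<Union>g\<in>carrier G. I g)"
  have IM: "I g \<subseteq> M" if "g \<in> carrier G" for g
    using c[OF that] by (auto simp: I_def geodesic_path_def)
  have YM: "Y \<subseteq> M" using IM by (auto simp: Y_def)
  have oI: "x0 \<in> I g" if "g \<in> carrier G" for g
    using c[OF that] by (force simp: I_def geodesic_path_def)
  have oY: "x0 \<in> Y" using oI[OF G.one_closed] by (auto simp: Y_def)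
  have seg: "e ` {0..d x0 x} \<subseteq> I g"
    if g: "g \<in> carrier G" and x: "x \<in> I g" and e: "geodesic_path M d x0 x e" for g x e
  proof -
    obtain s where s: "s \<in> {0..d x0 (\<phi> g x0)}" "x = c g s" using x by (auto simp: I_def)
    have cg: "c g 0 = x0" "c g \<in> {0..d x0 (\<phi> g x0)} \<rightarrow> M"
       "\<And>s t. \<lbrakk>s \<in> {0..d x0 (\<phi> g x0)}; t \<in> {0..d x0 (\<phi> g x0)}\<rbrakk> \<Longrightarrow> d (c g s) (c g t) = \<bar>s - t\<bar>"
      using c[OF g] by (auto simp: geodesic_path_def)
    have "e ` {0..d x0 x} = c g ` {0..s}"
    proof (rule geodesic_path_image_eq[OF T e x0])
      show "x \<in> M" using x IM[OF g] by blast
      show "inj_on (c g) {0..s}"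
        by (rule inj_on_subset[OF geodesic_path_inj[OF c[OF g] Metric_space_axioms]]) (use s in auto)
    qed (use s cg in auto)
    also have "\<dots> \<subseteq> I g" using s by (auto simp: I_def)
    finally show ?thesis .
  qed
  have conv: "e ` {0..d x y} \<subseteq> Y" if x: "x \<in> Y" and y: "y \<in> Y" and e: "geodesic_path M d x y e" for x y e
  proof -
    obtain g h where g: "g \<in> carrier G" "x \<in> I g" and h: "h \<in> carrier G" "y \<in> I h"
      using x y by (auto simp: Y_def)
    have xM: "x \<in> M" and yM: "y \<in> M" using x y YM by auto
    obtain a where a: "geodesic_path M d x0 x a" using real_tree_geodesic[OF T x0 xM] .
    obtain b where b: "geodesic_path M d x0 y b" using real_tree_geodesic[OF T x0 yM] .
    have "e ` {0..d x y} \<subseteq> a ` {0..d x0 x} \<union> b ` {0..d x0 y}"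
      by (rule real_tree_thin[OF T x0 xM yM a b e])
    also have "\<dots> \<subseteq> I g \<union> I h"
      by (rule Un_mono[OF seg[OF g a] seg[OF h b]])
    also have "\<dots> \<subseteq> Y" using g(1) h(1) by (auto simp: Y_def)
    finally show ?thesis .
  qed
  have inv: "\<phi> k x \<in> Y" if k: "k \<in> carrier G" and x: "x \<in> Y" for k x
  proof -
    obtain g where g: "g \<in> carrier G" "x \<in> I g" using x by (auto simp: Y_def)
    have oY': "\<phi> h x0 \<in> Y" if "h \<in> carrier G" for h
    proof -
      have "c h (d x0 (\<phi> h x0)) = \<phi> h x0" using c[OF that] unfolding geodesic_path_def by blast
      then have "\<phi> h x0 \<in> I h" unfolding I_def by (intro image_eqI[of _ _ "d x0 (\<phi> h x0)"]) auto
      then show ?thesis using that by (auto simp: Y_def)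
    qed
    have kg: "\<phi> (k \<otimes>\<^bsub>G\<^esub> g) x0 = \<phi> k (\<phi> g x0)" by (rule composition_rule[OF x0 k g(1)])
    have gM: "\<phi> g x0 \<in> M" by (rule cl[OF g(1) x0])
    have D: "d (\<phi> k x0) (\<phi> (k \<otimes>\<^bsub>G\<^esub> g) x0) = d x0 (\<phi> g x0)"
      unfolding kg by (rule iso[OF k x0 gM])
    have "geodesic_path M d (\<phi> k x0) (\<phi> (k \<otimes>\<^bsub>G\<^esub> g) x0) (\<lambda>t. \<phi> k (c g t))"
      using c[OF g(1)] cl[OF k] iso[OF k] gM x0 unfolding geodesic_path_def kg by (simp add: Pi_iff)
    from conv[OF oY'[OF k] oY'[OF G.m_closed[OF k g(1)]] this]
    have "(\<lambda>t. \<phi> k (c g t)) ` {0..d x0 (\<phi> g x0)} \<subseteq> Y"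
      unfolding D .
    then show ?thesis using g(2) unfolding I_def by blast
  qed
  have TY: "real_tree Y d"
    by (rule real_tree_convex_subset[OF T YM _ conv]) (use oY in auto)
  define f where "f y = (SOME g. g \<in> carrier G \<and> y \<in> I g, d x0 y)" for y
  have f: "fst (f y) \<in> carrier G" "y = c (fst (f y)) (snd (f y))" if "y \<in> Y" for y
  proof -
    have "\<exists>g. g \<in> carrier G \<and> y \<in> I g" using that by (auto simp: Y_def)
    from someI_ex[OF this] have s: "fst (f y) \<in> carrier G" "y \<in> I (fst (f y))" by (simp_all add: f_def)
    then obtain s where s': "s \<in> {0..d x0 (\<phi> (fst (f y)) x0)}" "y = c (fst (f y)) s" by (auto simp: I_def)
    have "d x0 y = s"
      using c[OF s(1)] s' unfolding geodesic_path_def by (metis abs_minus_commute abs_of_nonneg atLeastAtMost_iff diff_zero nonneg order_refl)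
    then show "fst (f y) \<in> carrier G" "y = c (fst (f y)) (snd (f y))" using s s' by (simp_all add: f_def)
  qed
  have inj: "inj_on f Y" by (rule inj_onI) (metis f(2))
  let ?h = "inv_into Y f"
  have hf: "?h (f y) = y" if "y \<in> Y" for y using inj that by simp
  define d' where "d' = (\<lambda>p q. d (?h p) (?h q))"
  define \<psi> where "\<psi> g = (\<lambda>p\<in>f ` Y. f (\<phi> g (?h p)))" for g
  have T': "real_tree (f ` Y) d'" unfolding d'_def by (rule real_tree_transfer[OF TY inj])
  have \<psi>f: "\<psi> g (f y) = f (\<phi> g y)" if "y \<in> Y" for g y using that by (simp add: \<psi>_def hf)
  have comp: "\<psi> g (\<psi> h p) = \<psi> (g \<otimes>\<^bsub>G\<^esub> h) p" if gh: "g \<in> carrier G" "h \<in> carrier G" and p: "p \<in> f ` Y" for g h p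
  proof -
    obtain y where y: "y \<in> Y" "p = f y" using p by blast
    have "\<phi> (g \<otimes>\<^bsub>G\<^esub> h) y = \<phi> g (\<phi> h y)"
      using YM y(1) by (intro composition_rule gh) auto
    then show ?thesis using \<psi>f[OF y(1)] \<psi>f[OF inv[OF gh(2) y(1)]] by (simp add: y(2))
  qed
  have one: "\<psi> \<one>\<^bsub>G\<^esub> p = p" if p: "p \<in> f ` Y" for p
  proof -
    obtain y where y: "y \<in> Y" "p = f y" using p by blast
    have "\<phi> \<one>\<^bsub>G\<^esub> y = y" using YM y(1) by (auto simp flip: id_eq_one)
    then show ?thesis using \<psi>f[OF y(1)] by (simp add: y(2))
  qed
  have into: "\<psi> g p \<in> f ` Y" if g: "g \<in> carrier G" and p: "p \<in> f ` Y" for g p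
  proof -
    obtain y where y: "y \<in> Y" "p = f y" using p by blast
    then show ?thesis using \<psi>f[OF y(1)] inv[OF g y(1)] by simp
  qed
  have Bij: "\<psi> g \<in> Bij (f ` Y)" if g: "g \<in> carrier G" for g
  proof -
    have "bij_betw (\<psi> g) (f ` Y) (f ` Y)"
      by (rule bij_betw_byWitness[where f' = "\<psi> (inv\<^bsub>G\<^esub> g)"])
         (use g in \<open>auto simp: comp one intro!: into simp del: image_iff\<close>)
    then show ?thesis by (simp add: Bij_def \<psi>_def)
  qed
  have "group_action G (f ` Y) \<psi>"
  proof (intro group_action.intro group_hom.intro group_hom_axioms.intro)
    show "\<psi> \<in> hom G (BijGroup (f ` Y))"
    proof (rule homI)
      fix g h assume gh: "g \<in> carrier G" "h \<in> carrier G"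
      have "\<psi> (g \<otimes>\<^bsub>G\<^esub> h) = compose (f ` Y) (\<psi> g) (\<psi> h)"
        proof (rule extensionalityI[of _ "f ` Y"])
        show "\<psi> (g \<otimes>\<^bsub>G\<^esub> h) \<in> extensional (f ` Y)" by (simp add: \<psi>_def)
      qed (simp_all add: compose_eq comp gh)
      then show "\<psi> (g \<otimes>\<^bsub>G\<^esub> h) = \<psi> g \<otimes>\<^bsub>BijGroup (f ` Y)\<^esub> \<psi> h"
        using gh Bij by (simp add: BijGroup_def)
    qed (use Bij in \<open>simp add: BijGroup_def\<close>)
  qed (auto simp: group_BijGroup)
  moreover have "d' (\<psi> g p) (\<psi> g q) = d' p q"
    if g: "g \<in> carrier G" and pq: "p \<in> f ` Y" "q \<in> f ` Y" for g p q
  proof -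
    obtain x y where xy: "x \<in> Y" "p = f x" "y \<in> Y" "q = f y" using pq by blast
    have "d (\<phi> g x) (\<phi> g y) = d x y" using xy YM by (intro iso g) auto
    then show ?thesis
      using hf[OF xy(1)] hf[OF xy(3)] hf[OF inv[OF g xy(1)]] hf[OF inv[OF g xy(3)]]
      by (simp add: d'_def xy(2,4) \<psi>f[OF xy(1)] \<psi>f[OF xy(3)])
  qed
  ultimately have A: "isometric_action G (f ` Y) d' \<psi>"
    by (simp add: isometric_action_def)
  have "\<exists>p\<in>f ` Y. \<forall>g\<in>carrier G. \<psi> g p = p"
    by (rule assms[unfolded property_FR_def FR_on_type_def, rule_format, OF conjI[OF T' A]])
  then obtain p where p: "p \<in> f ` Y" "\<forall>g\<in>carrier G. \<psi> g p = p" by blast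
  then obtain y where y: "y \<in> Y" "p = f y" by blast
  have "\<phi> g y = y" if "g \<in> carrier G" for g
      proof -
    have "f (\<phi> g y) = f y" using p(2) that by (simp add: y(2) flip: \<psi>f[OF y(1)])
    then show ?thesis using inj_onD[OF inj _ inv[OF that y(1)] y(1)] by blast
  qed
  then show "\<exists>x\<in>M. \<forall>g\<in>carrier G. \<phi> g x = x" using y YM by blast
qed

end

theory Submission
  imports Defs
begin

text \<open>
  Let \<open>G\<close> be generated by the finite set \<open>S\<close>, let \<open>T\<close> be an asymptotic cone of \<open>G\<close>, at scales
  \<open>r k\<close>, that is a real tree, and let \<open>\<phi>\<close> be an injective endomorphism.  Property (FR) is used
  twice: for actions on \<open>T\<close> and for actions on the real line.  If \<open>G\<close> is finite, \<open>\<phi>\<close> is surjective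
  by counting, so let \<open>G\<close> be infinite.

  \<^emph>\<open>Bounded energy.\<close> The energy of an endomorphism \<open>\<theta>\<close> is the least \<open>B\<close> such that some conjugate of
  \<open>\<theta>\<close> maps \<open>S\<close> into the ball of radius \<open>B\<close>.  The energy of \<open>\<phi>\<^sup>n\<^sup>+\<^sup>1\<close> is at most a constant times that
  of \<open>\<phi>\<^sup>n\<close>.  So if the energies were unbounded, at every scale \<open>r k\<close> there would be an iterate whose
  energy is comparable to \<open>r k\<close>; acting on \<open>T\<close> through these iterates, conjugated so as to
  realise the energy up to a constant factor, \<open>G\<close> would have no fixed point.  Hence the energies are
  bounded (\<open>FR_bounded_energy\<close>).
  Balls being finite, two iterates are conjugate, and some power \<open>\<Phi>\<close> of \<open>\<phi>\<close> satisfies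
  \<open>\<Phi> (\<Phi> x) = g \<Phi>(x) g\<inverse>\<close> for a fixed \<open>g\<close> (\<open>eventually_inner_power\<close>).

  \<^emph>\<open>Reduction to a centralizer.\<close> If \<open>g\<close> lies in the image of \<open>\<Phi>\<close>, say \<open>g = \<Phi> h\<close>, then injectivity
  gives that \<open>\<Phi>\<close> is conjugation by \<open>h\<close>, which is surjective.  Since \<open>\<Phi>\<close> is injective, it suffices for
  this that \<open>\<Phi>\<^sup>d g = g\<close> for some \<open>d > 0\<close>.  Put \<open>c = \<Phi>(g)\<inverse> g\<close>.  The elements \<open>z\<^sub>i = g\<^sup>-\<^sup>i c g\<^sup>i\<close>, \<open>i \<ge> 0\<close>,
  all centralize the image of \<open>\<Psi> = \<Phi> \<circ> \<Phi>\<close>, and if two of them coincide then a power \<open>g\<^sup>d\<close> commutes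
  with \<open>c\<close>, whence \<open>\<Phi>\<^sup>d g = g\<close>.

  \<^emph>\<open>The centralizer cannot move far.\<close> Suppose that all \<open>z\<^sub>i\<close> are distinct.  Their lengths are
  unbounded and grow by bounded steps, so some \<open>z\<^sub>i\<close> has length about \<open>r k\<close> for every \<open>k\<close>; these
  define an isometry \<open>z\<close> of \<open>T\<close> that moves the base point by \<open>1\<close>.  It commutes with \<open>\<Psi>(G)\<close>, so it
  moves every point of the image of the Lipschitz map \<open>T \<rightarrow> T\<close> induced by \<open>\<Psi>\<close> by the same amount.
  This image is connected, and it is not a point because \<open>\<Phi>\<close> restricted to \<open>\<Phi>(G)\<close> is a conjugation.
  An isometry of a tree with constant displacement on a nondegenerate subtree is a translation
  along it (\<open>constant_displacement_translation\<close>), and elements of \<open>\<Psi>(G)\<close> commute with it, hence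
  act along the same line.
  Going back to \<open>G\<close>: for some \<open>k\<close>, every element of \<open>\<Psi>(G)\<close> can be brought into the ball of radius
  \<open>r k\<close> by a power of the corresponding \<open>z\<^sub>i\<close>.  So \<open>\<Psi>(G)\<close> is infinite, commutes with \<open>z\<^sub>i\<close> and lies in
  finitely many cosets of \<open>\<langle>z\<^sub>i\<rangle>\<close>; a transfer argument then gives a nonzero homomorphism
  \<open>\<Psi>(G) \<rightarrow> \<int>\<close>, and composing it with \<open>\<Psi>\<close> lets \<open>G\<close> act on the real line without a fixed point.
\<close>

section \<open>The four-point condition and translations of trees\<close>

text \<open>Every triangle \<open>a\<close>, \<open>b\<close>, \<open>x\<close> of a real tree has a median: the geodesic from \<open>a\<close> to \<open>x\<close> is covered
  by two closed pieces, contained in the geodesics from \<open>b\<close> to its endpoints, and by connectedness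
  the pieces meet.  The fourth point \<open>y\<close> sees the median on its way to \<open>a\<close> or to \<open>x\<close>.\<close>

lemma real_tree_four_point:
  assumes T: "real_tree M d" and M: "a \<in> M" "b \<in> M" "x \<in> M" "y \<in> M"
  shows "d a x + d b y \<le> max (d a b + d x y) (d a y + d b x)"
proof -
  interpret Metric_space M d using T by (rule real_tree_metric)
  have split: "d u (c t) + d (c t) v = d u v"
    if "geodesic_path M d u v c" "t \<in> {0..d u v}" for u v c t
  proof -
    have "0 \<in> {0..d u v}" "d u v \<in> {0..d u v}" by simp_all
    then have "d (c 0) (c t) = \<bar>0 - t\<bar>" "d (c t) (c (d u v)) = \<bar>t - d u v\<bar>" "c 0 = u" "c (d u v) = v"
      using that unfolding geodesic_path_def by blast+
    then show ?thesis using that(2) by simp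
  qed
  have thin: "d u (e t) + d (e t) v = d u v \<or> d u (e t) + d (e t) w = d u w"
    if e: "geodesic_path M d v w e" and t: "t \<in> {0..d v w}" and uvw: "u \<in> M" "v \<in> M" "w \<in> M"
    for u v w e t
  proof -
    obtain p q where p: "geodesic_path M d u v p" and q: "geodesic_path M d u w q"
      using real_tree_geodesic[OF T] uvw by meson
    have "e t \<in> p ` {0..d u v} \<union> q ` {0..d u w}"
      using real_tree_thin[OF T uvw p q e] t by blast
    then show ?thesis using split[OF p] split[OF q] by auto
  qed
  obtain e where e: "geodesic_path M d a x e" using real_tree_geodesic[OF T M(1,3)] .
  let ?L = "d a x"
  have eM: "e t \<in> M" if "t \<in> {0..?L}" for t using e that by (auto simp: geodesic_path_def)
  have ed: "d (e s) (e t) = \<bar>s - t\<bar>" if "s \<in> {0..?L}" "t \<in> {0..?L}" for s t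
    using e that by (auto simp: geodesic_path_def)
  have e0: "e 0 = a" "e ?L = x" using e by (auto simp: geodesic_path_def)
  have lip: "\<bar>d u (e s) - d u (e t)\<bar> \<le> \<bar>s - t\<bar>" if "u \<in> M" "s \<in> {0..?L}" "t \<in> {0..?L}" for u s t
    using triangle[OF that(1) eM[OF that(2)] eM[OF that(3)]] triangle[OF that(1) eM[OF that(3)] eM[OF that(2)]]
      ed[OF that(2,3)] commute[of "e s" "e t"] by simp
  have cont: "continuous_on {0..?L} (\<lambda>s. d u (e s))" if "u \<in> M" for u
    unfolding continuous_on_iff
  proof (intro ballI allI impI)
    fix s \<epsilon> :: real assume "s \<in> {0..?L}" "0 < \<epsilon>"
    then show "\<exists>\<delta>>0. \<forall>t\<in>{0..?L}. dist t s < \<delta> \<longrightarrow> dist (d u (e t)) (d u (e s)) < \<epsilon>"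
      using lip[OF that] by (intro exI[of _ \<epsilon>]) (force simp: dist_real_def)
  qed
  \<comment> \<open>The excess of \<open>e s\<close> over the geodesics from \<open>b\<close> to \<open>a\<close> and to \<open>x\<close>: one of \<open>u\<close>, \<open>v\<close> always vanishes,
    so both do where they agree.\<close>
  define u where "u s = d b (e s) + d a (e s) - d a b" for s
  define v where "v s = d b (e s) + d x (e s) - d b x" for s
  have "continuous_on {0..?L} (\<lambda>s. u s - v s)"
    unfolding u_def v_def by (intro continuous_intros cont M)
  moreover have "u 0 - v 0 \<le> 0"
    using triangle[OF M(2) M(1) M(3)] M by (simp add: u_def v_def e0 commute)
  moreover have "0 \<le> u ?L - v ?L"
    using triangle[OF M(1) M(3) M(2)] M by (simp add: u_def v_def e0 commute)
  ultimately obtain s where s: "s \<in> {0..?L}" "u s = v s"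
    using IVT'[of "\<lambda>s. u s - v s" 0 0 ?L] by auto
  let ?p = "e s"
  have "u s = 0 \<or> v s = 0"
    using thin[OF e s(1) M(2,1,3)] by (auto simp: u_def v_def commute)
  then have bs: "d b ?p + d a ?p = d a b" "d b ?p + d x ?p = d b x" using s(2) by (auto simp: u_def v_def)
  have ax: "d a ?p + d ?p x = d a x" using split[OF e s(1)] .
  have by': "d b y \<le> d b ?p + d ?p y" using triangle[OF M(2) eM[OF s(1)] M(4)] .
  from thin[OF e s(1) M(4,1,3)] show ?thesis
    using bs ax by' by (auto simp: commute)
qed

text \<open>In a tree, an isometry \<open>Z\<close> that moves every point of a nondegenerate connected set by the same
  distance \<open>l\<close> is a translation along that set, so \<open>Z \<circ> Z\<close> moves its points by \<open>2 * l\<close>.  Indeed, near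
  a starting point \<open>o\<close> the path either runs along the geodesic from \<open>o\<close> to \<open>Z o\<close>, or continues the
  geodesic from \<open>Z o\<close> to \<open>o\<close> beyond \<open>o\<close>; in both cases two overlapping geodesics can be concatenated.
  A path cannot avoid both, since before leaving the geodesic sideways it has to run along it.
  The pseudometric \<open>D\<close> is meant to be the distance in the cone of the points represented by two
  sequences in a group.\<close>

lemma constant_displacement_translation:
  fixes D :: "'b \<Rightarrow> 'b \<Rightarrow> real"
  assumes sym: "\<And>x y. \<lbrakk>x \<in> P; y \<in> P\<rbrakk> \<Longrightarrow> D x y = D y x"
    and refl: "\<And>x. x \<in> P \<Longrightarrow> D x x = 0"
    and tri: "\<And>x y z. \<lbrakk>x \<in> P; y \<in> P; z \<in> P\<rbrakk> \<Longrightarrow> D x z \<le> D x y + D y z"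
    and four: "\<And>a b x y. \<lbrakk>a \<in> P; b \<in> P; x \<in> P; y \<in> P\<rbrakk> \<Longrightarrow> D a x + D b y \<le> max (D a b + D x y) (D a y + D b x)"
    and Z: "Z \<in> P \<rightarrow> P" "\<And>x y. \<lbrakk>x \<in> P; y \<in> P\<rbrakk> \<Longrightarrow> D (Z x) (Z y) = D x y"
    and \<eta>: "\<eta> \<in> {0..L} \<rightarrow> P" "\<And>s t. \<lbrakk>s \<in> {0..L}; t \<in> {0..L}\<rbrakk> \<Longrightarrow> D (\<eta> s) (\<eta> t) \<le> C * \<bar>s - t\<bar>"
    and "0 \<le> L" and ne: "0 < D (\<eta> 0) (\<eta> L)"
    and disp: "\<And>s. s \<in> {0..L} \<Longrightarrow> D (\<eta> s) (Z (\<eta> s)) = l" and "0 < l"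
  shows "\<exists>s\<in>{0..L}. D (\<eta> s) (Z (Z (\<eta> s))) = 2 * l"
proof (rule ccontr)
  assume contra: "\<not> ?thesis"
  have P: "\<eta> s \<in> P" if "s \<in> {0..L}" for s using \<eta>(1) that by blast
  have ZP: "Z x \<in> P" if "x \<in> P" for x using Z(1) that by blast
  let ?o = "\<eta> 0"
  have oP: "?o \<in> P" and L0: "0 \<in> {0..L}" "L \<in> {0..L}" using P \<open>0 \<le> L\<close> by auto
  define f where "f s = D ?o (\<eta> s)" for s
  \<comment> \<open>The Gromov product of \<open>\<eta> s\<close> and \<open>Z (\<eta> 0)\<close> at \<open>\<eta> 0\<close>: the length of the part that the geodesics
    from \<open>\<eta> 0\<close> to these two points have in common.\<close>
  define q where "q s = (f s + l - D (\<eta> s) (Z ?o)) / 2" for s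
  have lip: "\<bar>D (\<eta> s) u - D (\<eta> t) u\<bar> \<le> \<bar>C\<bar> * \<bar>s - t\<bar>" if "u \<in> P" "s \<in> {0..L}" "t \<in> {0..L}" for u s t
  proof -
    have "\<bar>D (\<eta> s) u - D (\<eta> t) u\<bar> \<le> D (\<eta> s) (\<eta> t)"
      using tri[OF P[OF that(2)] P[OF that(3)] that(1)] tri[OF P[OF that(3)] P[OF that(2)] that(1)]
        sym[OF P[OF that(2)] P[OF that(3)]] by simp
    also have "\<dots> \<le> C * \<bar>s - t\<bar>" using \<eta>(2) that by blast
    also have "\<dots> \<le> \<bar>C\<bar> * \<bar>s - t\<bar>" by (simp add: mult_right_mono)
    finally show ?thesis .
  qed
  have cont: "continuous_on {0..L} (\<lambda>s. D (\<eta> s) u)" if u: "u \<in> P" for u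
    unfolding continuous_on_iff
  proof (intro ballI allI impI)
    fix s \<epsilon> :: real assume s: "s \<in> {0..L}" and \<epsilon>: "0 < \<epsilon>"
    show "\<exists>\<delta>>0. \<forall>t\<in>{0..L}. dist t s < \<delta> \<longrightarrow> dist (D (\<eta> t) u) (D (\<eta> s) u) < \<epsilon>"
    proof (intro exI[of _ "\<epsilon> / (\<bar>C\<bar> + 1)"] conjI ballI impI)
      show "0 < \<epsilon> / (\<bar>C\<bar> + 1)" using \<epsilon> by simp
      fix t assume t: "t \<in> {0..L}" "dist t s < \<epsilon> / (\<bar>C\<bar> + 1)"
      have "\<bar>D (\<eta> t) u - D (\<eta> s) u\<bar> \<le> \<bar>C\<bar> * \<bar>t - s\<bar>" by (rule lip[OF u t(1) s])
      also have "\<dots> \<le> (\<bar>C\<bar> + 1) * \<bar>t - s\<bar>" by (intro mult_right_mono) auto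
      also have "\<dots> < \<epsilon>" using t(2) by (simp add: field_simps dist_real_def)
      finally show "dist (D (\<eta> t) u) (D (\<eta> s) u) < \<epsilon>" by (simp add: dist_real_def)
    qed
  qed
  have fc: "continuous_on {0..L} f"
    using cont[OF oP] by (rule continuous_on_eq) (simp add: f_def sym oP P)
  have qc: "continuous_on {0..L} q"
    unfolding q_def by (intro continuous_intros fc cont ZP oP) simp
  have f0: "f 0 = 0" by (simp add: f_def refl oP)
  have q0: "q 0 = 0" using disp[OF L0(1)] f0 by (simp add: q_def)
  \<comment> \<open>Stop the path before its distance from \<open>\<eta> 0\<close> reaches \<open>l\<close>: closer than that, the four points
    \<open>\<eta> 0\<close>, \<open>\<eta> s\<close> and their images are paired unambiguously in the four-point condition.\<close>
  obtain b where b: "b \<in> {0..L}" "0 < f b" and bl: "\<And>s. s \<in> {0..b} \<Longrightarrow> f s < l"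
  proof -
    define v where "v = min (f L) (l / 2)"
    have v: "0 < v" "v \<le> f L" "v < l" using ne \<open>0 < l\<close> by (auto simp: v_def f_def)
    define X where "X = {s \<in> {0..L}. v \<le> f s}"
    have "closed X" unfolding X_def by (rule continuous_on_closed_Collect_le) (auto intro: fc)
    then have "Inf X \<in> X"
      by (intro closed_contains_Inf bdd_belowI[of _ 0]) (use v L0 in \<open>auto simp: X_def\<close>)
    then have I: "Inf X \<in> {0..L}" "v \<le> f (Inf X)" by (auto simp: X_def)
    have less: "f s < v" if "s \<in> {0..<Inf X}" for s
      using that I cInf_lower[of s X] bdd_belowI[of X 0] by (fastforce simp: X_def not_le[symmetric])
    obtain y where y: "0 \<le> y" "y \<le> Inf X" "f y = v"
      using IVT'[of f 0 v "Inf X"] I v f0 continuous_on_subset[OF fc, of "{0..Inf X}"] by auto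
    then have "y = Inf X" using less[of y] by (cases "y = Inf X") auto
    then have "f s < l" if "s \<in> {0..Inf X}" for s
      using that y v less[of s] by (cases "s = Inf X") auto
    then show ?thesis using that[of "Inf X"] I v by auto
  qed
  have sub: "s \<in> {0..L}" if "s \<in> {0..b}" for s using that b(1) by auto
  have strict: "0 < q s \<and> q s < f s" if s: "s \<in> {0..b}" "0 < f s" for s
  proof -
    let ?y = "\<eta> s"
    note yP = P[OF sub[OF s(1)]]
    note Zs = ZP[OF oP] ZP[OF yP] ZP[OF ZP[OF oP]] ZP[OF ZP[OF yP]]
    have d: "D ?o (Z ?o) = l" "D ?y (Z ?y) = l" using disp[OF L0(1)] disp[OF sub[OF s(1)]] .
    have t: "D ?o ?y = f s" "D ?y ?o = f s" "f s < l" using bl[OF s(1)] sym[OF yP oP] by (simp_all add: f_def)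
    have Zd: "D (Z ?o) (Z ?y) = f s" "D (Z ?y) (Z ?o) = f s"
      "D (Z ?o) (Z (Z ?o)) = l" "D (Z ?y) (Z (Z ?y)) = l"
      "D (Z ?y) (Z (Z ?o)) = D ?y (Z ?o)" "D (Z ?o) (Z (Z ?y)) = D ?o (Z ?y)"
      using t d Z(2) oP yP Zs by simp_all
    \<comment> \<open>The sum \<open>l + l\<close> dominates \<open>f s + f s\<close>, so it equals the remaining one.\<close>
    have S: "D ?o (Z ?y) + D ?y (Z ?o) = 2 * l"
      using four[OF oP Zs(1) Zs(2) yP] four[OF oP yP Zs(1) Zs(2)] d t Zd
        sym[OF yP Zs(1)] sym[OF yP Zs(2)] sym[OF Zs(1,2)] by (auto simp: max_def split: if_splits)
    have "0 \<le> q s" "q s \<le> f s"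
      using tri[OF yP oP Zs(1)] tri[OF oP yP Zs(1)] d t by (simp_all add: q_def)
    moreover have "q s \<noteq> 0"
    proof
      assume "q s = 0"
      then have e: "D ?y (Z ?o) = f s + l" "D ?o (Z ?y) = l - f s" using S by (simp_all add: q_def)
      have "2 * l \<le> D ?y (Z (Z ?y))"
        using four[OF yP Zs(2) Zs(1) Zs(4)] d t e Zd s(2) by (auto simp: max_def split: if_splits)
      then have "D ?y (Z (Z ?y)) = 2 * l" using tri[OF yP Zs(2,4)] d Zd by simp
      then show False using contra sub[OF s(1)] by blast
    qed
    moreover have "q s \<noteq> f s"
    proof
      assume "q s = f s"
      then have e: "D ?y (Z ?o) = l - f s" "D ?o (Z ?y) = l + f s" using S by (simp_all add: q_def field_simps)
      have "2 * l \<le> D ?o (Z (Z ?o))"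
        using four[OF oP Zs(1) Zs(2) Zs(3)] d t e Zd s(2) by (auto simp: max_def split: if_splits)
      then have "D ?o (Z (Z ?o)) = 2 * l" using tri[OF oP Zs(1,3)] d Zd by simp
      then show False using contra L0 by blast
    qed
    ultimately show ?thesis by simp
  qed
  define X where "X = {s \<in> {0..b}. q b \<le> q s}"
  have sb: "{0..b} \<subseteq> {0..L}" using b(1) by auto
  have "closed X" unfolding X_def
    by (rule continuous_on_closed_Collect_le) (auto intro: continuous_on_subset[OF qc sb])
  then have I: "Inf X \<in> X"
    by (intro closed_contains_Inf bdd_belowI[of _ 0]) (use b in \<open>auto simp: X_def\<close>)
  define c where "c = Inf X"
  have c: "c \<in> {0..b}" "q b \<le> q c" using I by (auto simp: X_def c_def)
  have least: "q s < q b" if "s \<in> {0..<c}" for s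
    using that c cInf_lower[of s X] bdd_belowI[of X 0] by (fastforce simp: X_def c_def not_le[symmetric])
  have qb: "0 < q b" using strict[of b] b by simp
  have "c \<noteq> 0" using c(2) q0 qb by auto
  then have c0: "0 < c" using c(1) by simp
  obtain y where y: "0 \<le> y" "y \<le> c" "q y = q b"
    using IVT'[of q 0 "q b" c] c q0 qb continuous_on_subset[OF qc, of "{0..c}"] sb by auto
  have "y = c" using least[of y] y by (cases "y = c") auto
  then have qc': "q c = q b" using y by simp
  note cL = sub[OF c(1)]
  have "0 < f c" 
    using tri[OF P[OF cL] oP ZP[OF oP]] tri[OF oP P[OF cL] ZP[OF oP]] disp[OF L0(1)] qc' qb
      sym[OF oP P[OF cL]] by (simp add: q_def f_def)
  then have fq: "q c < f c" using strict[OF c(1)] by simp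
  \<comment> \<open>At the first time \<open>c\<close> at which the common part has length \<open>q b\<close>, the point \<open>\<eta> c\<close> is on a branch
    that left the geodesic at this length; so were the points shortly before.\<close>
  have "continuous_on {0..c} (\<lambda>s. (f s + f c - D (\<eta> s) (\<eta> c)) / 2)"
    using cL by (intro continuous_intros continuous_on_subset[OF fc] continuous_on_subset[OF cont[OF P[OF cL]]]) auto
  then have "((\<lambda>s. (f s + f c - D (\<eta> s) (\<eta> c)) / 2) \<longlongrightarrow> (f c + f c - D (\<eta> c) (\<eta> c)) / 2) (at c within {0..c})"
    using c0 by (auto simp: continuous_on_def dest!: bspec[where x = c])
  then have "((\<lambda>s. (f s + f c - D (\<eta> s) (\<eta> c)) / 2) \<longlongrightarrow> f c) (at_left c)"
    using c0 refl[OF P[OF cL]] by (simp add: at_within_Icc_at_left)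
  then have ev: "\<forall>\<^sub>F s in at_left c. q c < (f s + f c - D (\<eta> s) (\<eta> c)) / 2"
    using fq by (rule order_tendstoD)
  moreover have "\<forall>\<^sub>F s in at_left c. s \<in> {0<..<c}"
    using c0 by (intro eventually_at_left_real)
  ultimately have "\<forall>\<^sub>F s in at_left c. False"
  proof eventually_elim
    case (elim s)
    then have s: "s \<in> {0..b}" using c(1) by auto
    have "q s < q c" using least[of s] elim qc' by simp
    moreover have "q c \<le> q s"
    proof -
      note sP = P[OF sub[OF s]]
      show ?thesis
        using four[OF oP sP P[OF cL] ZP[OF oP]] elim(1) disp[OF L0(1)] \<open>q s < q c\<close>
          sym[OF sP P[OF cL]]
        by (auto simp: f_def q_def max_def field_simps split: if_splits)
    qed
    ultimately show False by simp
  qed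
  then show False by (simp add: trivial_limit_at_left_real[unfolded trivial_limit_def])
qed


section \<open>Real line actions and transfer\<close>

text \<open>\<^locale>\<open>group_action\<close> asks for bijections that are undefined off the set acted on, whence the
  restriction.\<close>

lemma group_action_restrictI:
  assumes "group G"
    and into: "\<And>g x. \<lbrakk>g \<in> carrier G; x \<in> M\<rbrakk> \<Longrightarrow> a g x \<in> M"
    and one: "\<And>x. x \<in> M \<Longrightarrow> a \<one>\<^bsub>G\<^esub> x = x"
    and mult: "\<And>g h x. \<lbrakk>g \<in> carrier G; h \<in> carrier G; x \<in> M\<rbrakk> \<Longrightarrow> a (g \<otimes>\<^bsub>G\<^esub> h) x = a g (a h x)"
  shows "group_action G M (\<lambda>g. \<lambda>x\<in>M. a g x)"
proof -
  interpret G: group G by fact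
  have Bij: "(\<lambda>x\<in>M. a g x) \<in> Bij M" if g: "g \<in> carrier G" for g
  proof -
    have "bij_betw (\<lambda>x\<in>M. a g x) M M"
      by (rule bij_betw_byWitness[where f' = "a (inv\<^bsub>G\<^esub> g)"])
         (use g in \<open>auto simp: into one simp flip: mult\<close>)
    then show ?thesis by (simp add: Bij_def)
  qed
  show ?thesis
  proof (intro group_action.intro group_hom.intro group_hom_axioms.intro homI)
    show "(\<lambda>x\<in>M. a (g \<otimes>\<^bsub>G\<^esub> h) x) = (\<lambda>x\<in>M. a g x) \<otimes>\<^bsub>BijGroup M\<^esub> (\<lambda>x\<in>M. a h x)"
      if "g \<in> carrier G" "h \<in> carrier G" for g h
      using that Bij by (auto simp: BijGroup_def compose_def mult into intro!: restrict_ext)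
  qed (use Bij assms(1) group_BijGroup in \<open>auto simp: BijGroup_def\<close>)
qed

lemma real_tree_real: "real_tree (UNIV :: real set) dist"
  unfolding real_tree_def
proof (intro conjI ballI allI impI)
  show "Metric_space UNIV (dist :: real \<Rightarrow> _)" by (rule Met_TC.Metric_space_axioms)
  fix x y :: real
  show "\<exists>c. geodesic_path UNIV dist x y c"
    by (intro exI[of _ "\<lambda>t. if x \<le> y then x + t else x - t"])
       (auto simp: geodesic_path_def dist_real_def)
  have arc: "c ` {0..1} = closed_segment x y" if "arc_path UNIV dist x y c" for c
  proof -
    have c: "continuous_on {0..1} c" "inj_on c {0..1}" "c 0 = x" "c 1 = y"
      using that by (auto simp: arc_path_def pathin_def)
    have "closed_segment x y \<subseteq> c ` {0..1}"
      using connected_continuous_image[OF c(1)] c(3,4)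
      by (intro closed_segment_subset) (auto simp: is_interval_convex_1[symmetric] is_interval_connected_1)
    moreover have "c t \<in> closed_segment x y" if t: "t \<in> {0..1}" for t
    proof (cases "t = 0 \<or> t = 1")
      case False
      then show ?thesis
        using continuous_inj_imp_mono[of 0 t 1 c] t c by (auto simp: closed_segment_eq_real_ivl)
    qed (use c in auto)
    ultimately show ?thesis by auto
  qed
  show "b ` {0..1} = c ` {0..1}" if "arc_path UNIV dist x y b \<and> arc_path UNIV dist x y c" for b c
    using that arc by blast
qed auto

text \<open>A homomorphism to the integers makes \<open>G\<close> act on the real line by translations, and a translation
  with a fixed point is trivial.\<close>

lemma FR_hom_int_trivial:
  fixes f :: "'a \<Rightarrow> int"
  assumes "group G" and FR: "property_FR G"
    and f: "\<And>x y. \<lbrakk>x \<in> carrier G; y \<in> carrier G\<rbrakk> \<Longrightarrow> f (x \<otimes>\<^bsub>G\<^esub> y) = f x + f y"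
    and x: "x \<in> carrier G"
  shows "f x = 0"
proof -
  interpret G: group G by fact
  have f1: "f \<one>\<^bsub>G\<^esub> = 0" using f[of "\<one>\<^bsub>G\<^esub>" "\<one>\<^bsub>G\<^esub>"] by simp
  let ?\<phi> = "\<lambda>g. \<lambda>t\<in>UNIV. real_of_int (f g) + t"
  have "group_action G UNIV ?\<phi>"
    by (rule group_action_restrictI) (auto simp: f f1 assms)
  then have "isometric_action G UNIV dist ?\<phi>"
    by (simp add: isometric_action_def)
  then obtain t where "\<forall>g\<in>carrier G. ?\<phi> g t = t"
    using property_FR_imp_FR_on_type[OF FR] real_tree_real unfolding FR_on_type_def by blast
  then show ?thesis using x by auto
qed

context group
begin

lemma subgroup_centralizer:
  assumes "X \<subseteq> carrier G"
  shows "subgroup {z \<in> carrier G. \<forall>x\<in>X. x \<otimes> z = z \<otimes> x} G"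
proof (rule subgroupI)
  fix a assume a: "a \<in> {z \<in> carrier G. \<forall>x\<in>X. x \<otimes> z = z \<otimes> x}"
  have "x \<otimes> inv a = inv a \<otimes> x" if "x \<in> X" for x
  proof -
    have "x \<otimes> a = a \<otimes> x" "x \<in> carrier G" "a \<in> carrier G" using a that assms by auto
    then have "inv a \<otimes> (x \<otimes> a) \<otimes> inv a = inv a \<otimes> (a \<otimes> x) \<otimes> inv a" by simp
    then show ?thesis
      using \<open>x \<in> carrier G\<close> \<open>a \<in> carrier G\<close> by (simp add: m_assoc flip: m_assoc[of "inv a" a])
  qed
  then show "inv a \<in> {z \<in> carrier G. \<forall>x\<in>X. x \<otimes> z = z \<otimes> x}" using a by auto
next
  fix a b assume "a \<in> {z \<in> carrier G. \<forall>x\<in>X. x \<otimes> z = z \<otimes> x}" "b \<in> {z \<in> carrier G. \<forall>x\<in>X. x \<otimes> z = z \<otimes> x}"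
  then show "a \<otimes> b \<in> {z \<in> carrier G. \<forall>x\<in>X. x \<otimes> z = z \<otimes> x}"
    using assms by (auto simp: subset_iff) (metis m_assoc)
qed (use assms in \<open>auto intro!: exI[of _ "\<one>"]\<close>)

text \<open>The transfer to \<open>\<langle>c\<rangle>\<close>.  The subgroup \<open>H\<close> permutes the finite set \<open>Q\<close> of cosets \<open>h\<langle>c\<rangle>\<close>; comparing
  \<open>h \<otimes> \<sigma> q\<close> with the representative \<open>\<sigma>\<close> of its coset gives an exponent of \<open>c\<close>, and these exponents,
  summed over \<open>q\<close>, form a homomorphism.  As \<open>H\<close> is infinite and \<open>Q\<close> finite, \<open>H\<close> contains a nontrivial
  power of \<open>c\<close>, on which the sum is the exponent times the number of cosets.\<close>

lemma commuting_coset_transfer: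
  assumes H: "subgroup H G" "infinite H" and c: "c \<in> carrier G" "\<And>h. h \<in> H \<Longrightarrow> h \<otimes> c = c \<otimes> h"
    and W: "finite W" "\<And>h. h \<in> H \<Longrightarrow> \<exists>m::int. h \<otimes> c [^] m \<in> W"
  obtains f :: "'a \<Rightarrow> int" and h
  where "\<And>x y. \<lbrakk>x \<in> H; y \<in> H\<rbrakk> \<Longrightarrow> f (x \<otimes> y) = f x + f y" "h \<in> H" "f h \<noteq> 0"
proof -
  interpret H: subgroup H G by fact
  define K where "K = range (\<lambda>m::int. c [^] m)"
  have cm: "c [^] m \<in> carrier G" for m :: int using c(1) by simp
  have hm: "h \<otimes> c [^] m = c [^] m \<otimes> h" if "h \<in> H" for h and m :: int
    using subgroup_int_pow_closed[OF subgroup_centralizer[OF H.subset]] c that by auto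
  have HK: "\<exists>w\<in>W. \<exists>m::int. h = w \<otimes> c [^] m" if "h \<in> H" for h
  proof -
    obtain m where m: "h \<otimes> c [^] (m::int) \<in> W" using W(2) \<open>h \<in> H\<close> by blast
    have "h = (h \<otimes> c [^] m) \<otimes> c [^] (- m)"
      using that c(1) by (simp add: m_assoc flip: int_pow_mult)
    then show ?thesis using m by blast
  qed
  have inf: "m = m'" if "c [^] m = c [^] m'" for m m' :: int
  proof (rule ccontr)
    assume "m \<noteq> m'"
    define d where "d = \<bar>m - m'\<bar>"
    have d: "0 < d" using \<open>m \<noteq> m'\<close> by (simp add: d_def)
    have "c [^] (m - m') = \<one>" "c [^] (m' - m) = \<one>" using \<open>c [^] m = c [^] m'\<close> c(1) by (simp_all add: int_pow_diff)
    then have cd: "c [^] d = \<one>" by (cases "m \<le> m'") (simp_all add: d_def)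
    have "c [^] i = c [^] (i mod d)" for i
    proof -
      have "c [^] i = c [^] (d * (i div d) + i mod d)" by simp
      also have "\<dots> = c [^] (d * (i div d)) \<otimes> c [^] (i mod d)" using c(1) by (rule int_pow_mult)
      also have "c [^] (d * (i div d)) = \<one>" using int_pow_pow[OF c(1), of d] cd by simp
      finally show ?thesis using cm by simp
    qed
    then have "K \<subseteq> (\<lambda>i. c [^] i) ` {0..<d}" using d by (fastforce simp: K_def)
    then have "finite K" using finite_subset by blast
    then have "finite ((\<lambda>(w, k). w \<otimes> k) ` (W \<times> K))" using W(1) by simp
    moreover have "H \<subseteq> (\<lambda>(w, k). w \<otimes> k) ` (W \<times> K)" using HK by (force simp: K_def)
    ultimately show False using H(2) finite_subset by blast
  qed
  define coset where "coset h = (\<lambda>k. h \<otimes> k) ` K" for h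
  define Q where "Q = coset ` H"
  have coset_mult: "coset (h \<otimes> c [^] m) = coset h" if "h \<in> carrier G" for h and m :: int
  proof -
    have "coset (h \<otimes> c [^] m) = range (\<lambda>j::int. h \<otimes> c [^] (m + j))"
      using that c(1) by (simp add: coset_def K_def image_image m_assoc int_pow_mult)
    also have "\<dots> = (\<lambda>j. h \<otimes> c [^] j) ` range (\<lambda>j::int. m + j)" by (simp only: image_image)
    also have "range (\<lambda>j::int. m + j) = UNIV" by (rule surj_plus)
    finally show ?thesis by (simp add: coset_def K_def image_image)
  qed
  have "Q \<subseteq> coset ` W"
  proof (unfold Q_def, rule image_subsetI)
    fix h assume h: "h \<in> H"
    obtain m where "h \<otimes> c [^] (m::int) \<in> W" using W(2)[OF h] by blast
    then show "coset h \<in> coset ` W" using coset_mult[of h m] h by (metis H.mem_carrier image_eqI)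
  qed
  then have finQ: "finite Q" using W(1) finite_subset by blast
  have selfc: "h \<in> coset h" if "h \<in> carrier G" for h
    using that by (auto simp: coset_def K_def intro!: image_eqI[where x = "c [^] (0::int)"])
  define \<sigma> where "\<sigma> q = (SOME h. h \<in> H \<and> coset h = q)" for q
  have \<sigma>: "\<sigma> q \<in> H" "coset (\<sigma> q) = q" if "q \<in> Q" for q
    using someI_ex[of "\<lambda>h. h \<in> H \<and> coset h = q"] that by (auto simp: \<sigma>_def Q_def)
  have \<sigma>G: "\<sigma> q \<in> carrier G" if "q \<in> Q" for q using \<sigma>(1)[OF that] by (rule H.mem_carrier)
  have ex: "\<exists>m::int. h = h' \<otimes> c [^] m" if "coset h = coset h'" "h \<in> carrier G" for h h'
    using that selfc[of h] by (auto simp: coset_def K_def)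
  define p where "p h q = coset (h \<otimes> \<sigma> q)" for h q
  have pQ: "p h q \<in> Q" if "h \<in> H" "q \<in> Q" for h q using that \<sigma>(1) by (auto simp: p_def Q_def)
  \<comment> \<open>The cocycle of exponents of \<open>c\<close>.\<close>
  define m where "m h q = (THE m::int. h \<otimes> \<sigma> q = \<sigma> (p h q) \<otimes> c [^] m)" for h q
  have m_unique: "m h q = j" if "h \<otimes> \<sigma> q = \<sigma> (p h q) \<otimes> c [^] j" "h \<in> H" "q \<in> Q" for h q j
    unfolding m_def
  proof (rule the_equality)
    fix k :: int assume "h \<otimes> \<sigma> q = \<sigma> (p h q) \<otimes> c [^] k"
    then have "c [^] k = c [^] j" 
      using that(1) Units_l_cancel[of "\<sigma> (p h q)" "c [^] k" "c [^] j"] \<sigma>G[OF pQ[OF that(2,3)]] cm by simp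
    then show "k = j" by (rule inf)
  qed fact
  have m: "h \<otimes> \<sigma> q = \<sigma> (p h q) \<otimes> c [^] m h q" if hq: "h \<in> H" "q \<in> Q" for h q
  proof -
    have "coset (h \<otimes> \<sigma> q) = coset (\<sigma> (p h q))" using \<sigma>(2)[OF pQ[OF hq]] by (simp add: p_def)
    then obtain j where "h \<otimes> \<sigma> q = \<sigma> (p h q) \<otimes> c [^] (j::int)"
      using ex m_closed[OF H.mem_carrier[OF hq(1)] \<sigma>G[OF hq(2)]] by blast
    then show ?thesis using m_unique[OF _ hq] by simp
  qed
  have p_mult: "p (x \<otimes> y) q = p x (p y q)" 
    and m_mult: "m (x \<otimes> y) q = m x (p y q) + m y q" if "x \<in> H" "y \<in> H" "q \<in> Q" for x y q
  proof -
    note cl = H.mem_carrier[OF that(1)] H.mem_carrier[OF that(2)] \<sigma>G[OF that(3)]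
      \<sigma>G[OF pQ[OF that(2,3)]] \<sigma>G[OF pQ[OF that(1) pQ[OF that(2,3)]]] cm
    have "(x \<otimes> y) \<otimes> \<sigma> q = x \<otimes> (\<sigma> (p y q) \<otimes> c [^] m y q)"
      using m[OF that(2,3)] cl by (simp add: m_assoc)
    also have e: "\<dots> = (x \<otimes> \<sigma> (p y q)) \<otimes> c [^] m y q" using cl by (simp add: m_assoc)
    finally have 1: "(x \<otimes> y) \<otimes> \<sigma> q = (x \<otimes> \<sigma> (p y q)) \<otimes> c [^] m y q" .
    then show 2: "p (x \<otimes> y) q = p x (p y q)"
      using cl by (simp add: p_def coset_mult)
    have "(x \<otimes> y) \<otimes> \<sigma> q = \<sigma> (p x (p y q)) \<otimes> c [^] (m x (p y q) + m y q)"
      using 1 m[OF that(1) pQ[OF that(2,3)]] cl c(1) by (simp add: m_assoc int_pow_mult)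
    then show "m (x \<otimes> y) q = m x (p y q) + m y q"
      using that by (intro m_unique) (simp_all add: 2)
  qed
  define f where "f h = (\<Sum>q\<in>Q. m h q)" for h
  have bij: "bij_betw (p y) Q Q" if y: "y \<in> H" for y
  proof -
    have p1: "p \<one> q = q" if "q \<in> Q" for q using that \<sigma> \<sigma>G by (simp add: p_def)
    show ?thesis
      by (rule bij_betw_byWitness[where f' = "p (inv y)"])
        (use y p1 in \<open>auto simp: pQ simp flip: p_mult\<close>)
  qed
  have add: "f (x \<otimes> y) = f x + f y" if xy: "x \<in> H" "y \<in> H" for x y
  proof -
    have "(\<Sum>q\<in>Q. m x (p y q)) = (\<Sum>q\<in>Q. m x q)"
      by (rule sum.reindex_bij_betw[OF bij[OF xy(2)]])
    then show ?thesis by (simp add: f_def m_mult[OF xy] sum.distrib)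
  qed
  have "\<not> inj_on coset H" using finQ H(2) finite_imageD unfolding Q_def by blast
  then obtain x y where xy: "x \<in> H" "y \<in> H" "coset x = coset y" "x \<noteq> y" by (auto simp: inj_on_def)
  then obtain j where j: "x = y \<otimes> c [^] (j::int)" using ex H.mem_carrier by metis
  have "j \<noteq> 0" using j xy by auto
  have jH: "c [^] j \<in> H"
  proof -
    have "c [^] j = inv y \<otimes> x" using j xy cm by (simp add: m_assoc[symmetric])
    then show ?thesis using xy by simp
  qed
  have "m (c [^] j) q = j" if q: "q \<in> Q" for q
  proof (rule m_unique[OF _ jH q])
    have e: "c [^] j \<otimes> \<sigma> q = \<sigma> q \<otimes> c [^] j" using hm[OF \<sigma>(1)[OF q]] by simp
    then have "p (c [^] j) q = q" using coset_mult[OF \<sigma>G[OF q]] \<sigma>(2)[OF q] by (simp add: p_def)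
    then show "c [^] j \<otimes> \<sigma> q = \<sigma> (p (c [^] j) q) \<otimes> c [^] j" using e by simp
  qed
  then have "f (c [^] j) = j * int (card Q)" by (simp add: f_def)
  moreover have "Q \<noteq> {}" using xy(1) by (auto simp: Q_def)
  ultimately have "f (c [^] j) \<noteq> 0" using \<open>j \<noteq> 0\<close> finQ by simp
  then show ?thesis using that add jH by blast
qed

end


section \<open>Word lengths and homomorphisms\<close>

locale word_metric = group G for G (structure) +
  fixes S
  assumes gen: "generating_set G S" and finS: "finite S"
begin

abbreviation "len \<equiv> word_length G S"
abbreviation "letters \<equiv> S \<union> (\<lambda>s. inv s) ` S"
abbreviation "wd \<equiv> word_dist G S"

lemma S_carrier: "s \<in> S \<Longrightarrow> s \<in> carrier G"
  using gen by (auto simp: generating_set_def)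

lemma letters_carrier: "a \<in> letters \<Longrightarrow> a \<in> carrier G"
  using S_carrier by auto

lemmas len_one = word_length_one[OF gen]
  and len_mult = word_length_mult[OF gen]
  and len_inv = word_length_inv[OF gen]

lemma len_letter: "a \<in> letters \<Longrightarrow> len a \<le> 1"
  using word_length_le[OF gen, of "[a]"] letters_carrier[of a] by simp

lemma len_mult3:
  assumes "x \<in> carrier G" "y \<in> carrier G" "z \<in> carrier G"
  shows "len (x \<otimes> y \<otimes> z) \<le> len x + len y + len z"
  using len_mult[of "x \<otimes> y" z] len_mult[of x y] assms by simp

lemma finite_ball: "finite {g \<in> carrier G. len g \<le> N}"
proof (rule finite_subset)
  show "{g \<in> carrier G. len g \<le> N} \<subseteq> (\<lambda>w. foldr (\<lambda>x y. x \<otimes> y) w \<one>) ` {w. set w \<subseteq> letters \<and> length w \<le> N}"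
  proof
    fix g assume g: "g \<in> {g \<in> carrier G. len g \<le> N}"
    then obtain w where "set w \<subseteq> letters" "length w = len g" "foldr (\<lambda>x y. x \<otimes> y) w \<one> = g"
      using word_length_witness[OF gen] by blast
    then show "g \<in> (\<lambda>w. foldr (\<lambda>x y. x \<otimes> y) w \<one>) ` {w. set w \<subseteq> letters \<and> length w \<le> N}"
      using g by (intro image_eqI[of _ _ w]) auto
  qed
  show "finite ((\<lambda>w. foldr (\<lambda>x y. x \<otimes> y) w \<one>) ` {w. set w \<subseteq> letters \<and> length w \<le> N})"
    using finS by (intro finite_imageI finite_lists_length_le) simp
qed

lemma word_length_induct [consumes 1, case_names one letter]:
  assumes "g \<in> carrier G" and one: "P \<one>"
    and step: "\<And>a x. \<lbrakk>a \<in> letters; x \<in> carrier G; len (a \<otimes> x) = Suc (len x); P x\<rbrakk> \<Longrightarrow> P (a \<otimes> x)"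
  shows "P g"
  using assms(1)
proof (induction "len g" arbitrary: g)
  case 0
  then obtain w where "length w = 0" "foldr (\<lambda>x y. x \<otimes> y) w \<one> = g"
    using word_length_witness[OF gen, of g] by metis
  then show ?case using one by simp
next
  case (Suc n)
  then obtain w where w: "set w \<subseteq> letters" "length w = Suc n" "foldr (\<lambda>x y. x \<otimes> y) w \<one> = g"
    using word_length_witness[OF gen, of g] by metis
  then obtain a v where av: "w = a # v" by (cases w) auto
  define x where "x = foldr (\<lambda>x y. x \<otimes> y) v \<one>"
  have a: "a \<in> letters" and v: "set v \<subseteq> letters" using w av by auto
  have x: "x \<in> carrier G" unfolding x_def by (rule foldr_mult_closed) (use v letters_carrier in blast)
  have g: "g = a \<otimes> x" using w av by (simp add: x_def)
  have "len x \<le> n" using word_length_le[OF gen v] w av by (simp add: x_def)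
  moreover have "Suc n \<le> 1 + len x"
    using len_mult[OF letters_carrier[OF a] x] len_letter[OF a] Suc(2) g by simp
  ultimately have n: "n = len x" by simp
  show ?case unfolding g by (rule step[OF a x _ Suc(1)[OF n x]]) (use n Suc(2) g in simp)
qed

lemma len_hom_letter:
  assumes "\<theta> \<in> hom G G" and "\<And>s. s \<in> S \<Longrightarrow> len (\<theta> s) \<le> C" and "a \<in> letters"
  shows "len (\<theta> a) \<le> C"
proof -
  interpret \<theta>: group_hom G G \<theta> by unfold_locales fact
  show ?thesis using assms by (auto simp: len_inv S_carrier)
qed

lemma len_hom_le:
  assumes \<theta>: "\<theta> \<in> hom G G" and C: "\<And>s. s \<in> S \<Longrightarrow> len (\<theta> s) \<le> C" and g: "g \<in> carrier G"
  shows "len (\<theta> g) \<le> C * len g"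
  using g
proof (induction g rule: word_length_induct)
  case one
  interpret \<theta>: group_hom G G \<theta> by unfold_locales fact
  show ?case by (simp add: len_one)
next
  case (letter a x)
  note cl = letters_carrier[OF letter(1)] letter(2)
  interpret \<theta>: group_hom G G \<theta> by unfold_locales fact
  have "len (\<theta> (a \<otimes> x)) \<le> len (\<theta> a) + len (\<theta> x)"
    using cl len_mult[of "\<theta> a" "\<theta> x"] by simp
  also have "\<dots> \<le> C + C * len x" using len_hom_letter[OF \<theta> C letter(1)] letter by simp
  finally show ?case using letter by simp
qed

text \<open>Along a word, the length of the image grows by steps of at most \<open>C\<close>, so it cannot jump over the
  window between \<open>R\<close> and \<open>R + C\<close>.\<close>

lemma hom_image_length:
  fixes R :: real
  assumes \<theta>: "\<theta> \<in> hom G G" and C: "\<And>s. s \<in> S \<Longrightarrow> len (\<theta> s) \<le> C"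
    and inf: "infinite (\<theta> ` carrier G)" and "0 \<le> R"
  shows "\<exists>y\<in>carrier G. R \<le> len (\<theta> y) \<and> len (\<theta> y) \<le> R + C"
proof (rule ccontr)
  assume no: "\<not> ?thesis"
  interpret \<theta>: group_hom G G \<theta> by unfold_locales fact
  have "len (\<theta> y) < R + 1" if "y \<in> carrier G" for y
  proof -
    have "len (\<theta> y) < R \<or> (y = \<one> \<and> R = 0)"
      using that
    proof (induction y rule: word_length_induct)
      case one show ?case using \<open>0 \<le> R\<close> by (auto simp: len_one)
    next
      case (letter a x)
      note cl = letters_carrier[OF letter(1)] letter(2)
      have "len (\<theta> (a \<otimes> x)) \<le> len (\<theta> a) + len (\<theta> x)"
        using cl len_mult[of "\<theta> a" "\<theta> x"] by simp
      then have "len (\<theta> (a \<otimes> x)) \<le> C + len (\<theta> x)"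
        using len_hom_letter[OF \<theta> C letter(1)] by simp
      then have "real (len (\<theta> (a \<otimes> x))) \<le> C + real (len (\<theta> x))"
        by linarith
      also have "\<dots> \<le> R + C" using letter(4) by (auto simp: len_one)
      finally show ?case using no cl by (meson m_closed not_le)
    qed
    then show ?thesis by (auto simp: len_one)
  qed
  then have "real (len (\<theta> y)) \<le> real (nat \<lceil>R + 1\<rceil>)" if "y \<in> carrier G" for y
    using real_nat_ceiling_ge[of "R + 1"] that by (meson less_imp_le order_trans)
  then have "\<theta> ` carrier G \<subseteq> {g \<in> carrier G. len g \<le> nat \<lceil>R + 1\<rceil>}" using of_nat_le_iff by auto
  then show False using inf finite_ball finite_subset by blast
qed

lemma wd_left: "\<lbrakk>a \<in> carrier G; x \<in> carrier G; y \<in> carrier G\<rbrakk> \<Longrightarrow> wd (a \<otimes> x) (a \<otimes> y) = wd x y"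
  by (simp add: word_dist_def inv_mult_group m_assoc) (simp flip: m_assoc)

lemma wd_sym: "\<lbrakk>x \<in> carrier G; y \<in> carrier G\<rbrakk> \<Longrightarrow> wd x y = wd y x"
  using len_inv[of "inv x \<otimes> y"] by (simp add: word_dist_def inv_mult_group)

lemma wd_tri:
  assumes "x \<in> carrier G" "y \<in> carrier G" "z \<in> carrier G"
  shows "wd x z \<le> wd x y + wd y z"
proof -
  have "y \<otimes> (inv y \<otimes> z) = z" using assms by (simp flip: m_assoc)
  then have "(inv x \<otimes> y) \<otimes> (inv y \<otimes> z) = inv x \<otimes> z" using assms by (simp add: m_assoc)
  then show ?thesis
    using len_mult[of "inv x \<otimes> y" "inv y \<otimes> z"] assms by (simp add: word_dist_def flip: of_nat_add)
qed

lemma wd_one: "x \<in> carrier G \<Longrightarrow> wd \<one> x = len x" "x \<in> carrier G \<Longrightarrow> wd x \<one> = len x"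
  by (simp_all add: word_dist_def len_inv)

lemma wd_refl: "x \<in> carrier G \<Longrightarrow> wd x x = 0"
  by (simp add: word_dist_def len_one)

end


section \<open>Asymptotic cones that are real trees\<close>

locale tree_cone = word_metric G S for G (structure) and S +
  fixes \<omega> :: "nat filter" and r :: "nat \<Rightarrow> real"
  assumes ultra: "nonprincipal_ultrafilter \<omega>"
    and r_pos: "\<And>n. 0 < r n" and r_lim: "filterlim r at_top sequentially"
    and tree: "real_tree (asymptotic_cone G S \<omega> r) (asymptotic_cone_dist G S \<omega> r)"
begin

text \<open>The sequences that represent points of the cone; \<open>lim_dist\<close> below is the distance in the cone of
  the points represented by two of them.\<close>

definition "bounded_seqs = {x. (\<forall>n. x n \<in> carrier G) \<and> (\<exists>C. \<forall>\<^sub>F n in \<omega>. len (x n) \<le> C * r n)}"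
definition "lim_dist x y = Lim \<omega> (\<lambda>n. wd (x n) (y n) / r n)"
abbreviation "acone \<equiv> asymptotic_cone G S \<omega> r"
abbreviation "acone_dist \<equiv> asymptotic_cone_dist G S \<omega> r"

lemma omega_nontrivial: "\<omega> \<noteq> bot"
  using ultra by (simp add: nonprincipal_ultrafilter_def)

lemma omega_cofinite: "\<omega> \<le> sequentially"
proof -
  have "\<forall>\<^sub>F n in \<omega>. N \<le> n" for N
  proof -
    have "\<forall>\<^sub>F n in \<omega>. n \<noteq> m" for m using ultra unfolding nonprincipal_ultrafilter_def by blast
    then have "\<forall>\<^sub>F n in \<omega>. \<forall>m\<in>{..<N}. n \<noteq> m" by (simp add: eventually_ball_finite_distrib)
    then show ?thesis by (rule eventually_mono) force
  qed
  then show ?thesis unfolding le_filter_def eventually_sequentially by (metis (lifting) eventually_mono)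
qed

lemma eventually_r_ge: "\<forall>\<^sub>F n in \<omega>. K \<le> r n"
  using filter_leD[OF omega_cofinite] r_lim by (auto simp: filterlim_at_top)

lemma tendsto_div_r: "((\<lambda>n. K / r n) \<longlongrightarrow> 0) \<omega>"
  using filterlim_mono[OF r_lim order_refl omega_cofinite] 
  by (intro real_tendsto_divide_at_top[OF tendsto_const])

lemma bounded_seqsD: "x \<in> bounded_seqs \<Longrightarrow> x n \<in> carrier G"
  by (simp add: bounded_seqs_def)

lemma bounded_seqsI: "\<lbrakk>\<And>n. x n \<in> carrier G; \<forall>\<^sub>F n in \<omega>. len (x n) \<le> C * r n\<rbrakk> \<Longrightarrow> x \<in> bounded_seqs"
  by (auto simp: bounded_seqs_def)

lemma bounded_seqs_const [simp, intro]: "g \<in> carrier G \<Longrightarrow> (\<lambda>n. g) \<in> bounded_seqs"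
  by (rule bounded_seqsI[where C = 1]) (use eventually_r_ge in simp_all)

lemma bounded_seqs_mult [simp, intro]:
  assumes "x \<in> bounded_seqs" "y \<in> bounded_seqs" shows "(\<lambda>n. x n \<otimes> y n) \<in> bounded_seqs"
proof -
  obtain B C where "\<forall>\<^sub>F n in \<omega>. len (x n) \<le> B * r n" "\<forall>\<^sub>F n in \<omega>. len (y n) \<le> C * r n"
    using assms by (auto simp: bounded_seqs_def)
  then have "\<forall>\<^sub>F n in \<omega>. len (x n \<otimes> y n) \<le> (B + C) * r n"
  proof eventually_elim
    case (elim n)
    then show ?case using len_mult[OF bounded_seqsD bounded_seqsD, OF assms, of n n] by (simp add: distrib_right)
  qed
  then show ?thesis using assms by (intro bounded_seqsI) (simp_all add: bounded_seqsD)
qed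

lemma bounded_seqs_inv [simp, intro]: "x \<in> bounded_seqs \<Longrightarrow> (\<lambda>n. inv (x n)) \<in> bounded_seqs"
  by (auto simp: bounded_seqs_def len_inv)

lemma lim_dist_tendsto:
  assumes "x \<in> bounded_seqs" "y \<in> bounded_seqs"
  shows "((\<lambda>n. wd (x n) (y n) / r n) \<longlongrightarrow> lim_dist x y) \<omega>"
proof -
  obtain C where "\<forall>\<^sub>F n in \<omega>. len (inv (x n) \<otimes> y n) \<le> C * r n"
    using bounded_seqs_mult[OF bounded_seqs_inv[OF assms(1)] assms(2)] by (auto simp: bounded_seqs_def)
  then have "\<forall>\<^sub>F n in \<omega>. \<bar>wd (x n) (y n) / r n\<bar> \<le> C"
    by (rule eventually_mono) (use r_pos in \<open>simp add: word_dist_def divide_simps abs_of_pos\<close>)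
  from ultrafilter_bounded_convergent[OF ultra this] obtain l
    where l: "((\<lambda>n. wd (x n) (y n) / r n) \<longlongrightarrow> l) \<omega>" ..
  then show ?thesis using tendsto_Lim[OF omega_nontrivial l] by (simp add: lim_dist_def)
qed

lemma lim_dist_eqI: "((\<lambda>n. wd (x n) (y n) / r n) \<longlongrightarrow> l) \<omega> \<Longrightarrow> lim_dist x y = l"
  unfolding lim_dist_def by (rule tendsto_Lim[OF omega_nontrivial])

lemma lim_dist_geI: "\<lbrakk>x \<in> bounded_seqs; y \<in> bounded_seqs; \<forall>\<^sub>F n in \<omega>. c * r n \<le> wd (x n) (y n)\<rbrakk> \<Longrightarrow> c \<le> lim_dist x y"
  by (rule tendsto_lowerbound[OF lim_dist_tendsto _ omega_nontrivial])
     (auto elim!: eventually_mono simp: pos_le_divide_eq r_pos)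

lemma lim_dist_leI:
  assumes "x \<in> bounded_seqs" "y \<in> bounded_seqs" "\<forall>\<^sub>F n in \<omega>. wd (x n) (y n) \<le> c * r n + K"
  shows "lim_dist x y \<le> c"
proof -
  have "((\<lambda>n. c + K / r n) \<longlongrightarrow> c + 0) \<omega>" by (intro tendsto_intros tendsto_div_r)
  moreover have "\<forall>\<^sub>F n in \<omega>. wd (x n) (y n) / r n \<le> c + K / r n"
    using assms(3) by (rule eventually_mono) (use r_pos in \<open>simp add: divide_simps\<close>, metis less_irrefl)
  ultimately show ?thesis
    using tendsto_le[OF omega_nontrivial _ lim_dist_tendsto[OF assms(1,2)]] by simp
qed

lemma lim_dist_refl: "x \<in> bounded_seqs \<Longrightarrow> lim_dist x x = 0"
  by (rule lim_dist_eqI) (simp add: wd_refl bounded_seqsD)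

lemma lim_dist_sym: "\<lbrakk>x \<in> bounded_seqs; y \<in> bounded_seqs\<rbrakk> \<Longrightarrow> lim_dist x y = lim_dist y x"
  unfolding lim_dist_def by (simp add: wd_sym bounded_seqsD)

lemma lim_dist_nonneg: "\<lbrakk>x \<in> bounded_seqs; y \<in> bounded_seqs\<rbrakk> \<Longrightarrow> 0 \<le> lim_dist x y"
  by (rule lim_dist_geI) (simp_all add: word_dist_def)

lemma lim_dist_tri:
  assumes "x \<in> bounded_seqs" "y \<in> bounded_seqs" "z \<in> bounded_seqs" shows "lim_dist x z \<le> lim_dist x y + lim_dist y z"
proof (rule tendsto_le[OF omega_nontrivial tendsto_add[OF lim_dist_tendsto[OF assms(1,2)] lim_dist_tendsto[OF assms(2,3)]] lim_dist_tendsto[OF assms(1,3)]])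
  have "wd (x n) (z n) / r n \<le> (wd (x n) (y n) + wd (y n) (z n)) / r n" for n
    using wd_tri[OF bounded_seqsD bounded_seqsD bounded_seqsD, OF assms] less_imp_le[OF r_pos] by (rule divide_right_mono)
  then show "\<forall>\<^sub>F n in \<omega>. wd (x n) (z n) / r n \<le> wd (x n) (y n) / r n + wd (y n) (z n) / r n"
    by (simp add: add_divide_distrib)
qed

lemma lim_dist_left:
  assumes "a \<in> bounded_seqs" "x \<in> bounded_seqs" "y \<in> bounded_seqs"
  shows "lim_dist (\<lambda>n. a n \<otimes> x n) (\<lambda>n. a n \<otimes> y n) = lim_dist x y"
  unfolding lim_dist_def using assms by (simp add: wd_left bounded_seqsD)

abbreviation "rel \<equiv> ultralimit_rel \<omega> (\<lambda>n. carrier G) (\<lambda>n g h. wd g h / r n) (\<lambda>n. \<one>)"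
text \<open>The point of the cone represented by a bounded sequence.\<close>

definition "cone_pt x = rel `` {x}"

lemma seqs_eq: "ultralimit_seqs \<omega> (\<lambda>n. carrier G) (\<lambda>n g h. wd g h / r n) (\<lambda>n. \<one>) = bounded_seqs"
  using r_pos by (auto simp: ultralimit_seqs_def bounded_seqs_def wd_one pos_divide_le_eq)

lemma rel_iff: "(x, y) \<in> rel \<longleftrightarrow> x \<in> bounded_seqs \<and> y \<in> bounded_seqs \<and> lim_dist x y = 0"
  using lim_dist_tendsto[of x y] lim_dist_eqI[of x y 0] by (auto simp: ultralimit_rel_def seqs_eq)

lemma equiv_rel: "equiv bounded_seqs rel"
proof (rule equivI)
  show "rel \<subseteq> bounded_seqs \<times> bounded_seqs" by (auto simp: rel_iff)
  show "refl_on bounded_seqs rel" by (auto simp: refl_on_def rel_iff lim_dist_refl)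
  show "sym rel" by (auto simp: sym_def rel_iff lim_dist_sym)
  show "trans rel"
  proof (rule transI)
    fix x y z assume "(x, y) \<in> rel" "(y, z) \<in> rel"
    then show "(x, z) \<in> rel" using lim_dist_tri[of x y z] lim_dist_nonneg[of x z] by (auto simp: rel_iff)
  qed
qed

lemma cone_eq: "acone = cone_pt ` bounded_seqs"
  by (auto simp: asymptotic_cone_def ultralimit_def seqs_eq quotient_def cone_pt_def)

lemma cone_pt_eq_iff: "\<lbrakk>x \<in> bounded_seqs; y \<in> bounded_seqs\<rbrakk> \<Longrightarrow> cone_pt x = cone_pt y \<longleftrightarrow> lim_dist x y = 0"
  unfolding cone_pt_def using eq_equiv_class_iff[OF equiv_rel] by (simp add: rel_iff)

lemma cone_pt_in: "x \<in> bounded_seqs \<Longrightarrow> cone_pt x \<in> acone"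
  by (simp add: cone_eq)

definition "rep A = (SOME x. x \<in> A)"

lemma rep:
  assumes "A \<in> acone" shows rep_bounded: "rep A \<in> bounded_seqs" and cone_pt_rep: "cone_pt (rep A) = A"
proof -
  obtain x where x: "x \<in> bounded_seqs" "A = cone_pt x" using assms by (auto simp: cone_eq)
  then have "x \<in> A" using equiv_class_self[OF equiv_rel] by (simp add: cone_pt_def)
  then have "rep A \<in> A" unfolding rep_def by (rule someI[where P = "\<lambda>x. x \<in> A"])
  then have "(x, rep A) \<in> rel" using x(2) by (simp add: cone_pt_def)
  then show "rep A \<in> bounded_seqs" "cone_pt (rep A) = A" using x cone_pt_eq_iff[of x "rep A"] by (auto simp: rel_iff)
qed

lemma lim_dist_cong:
  assumes "x \<in> bounded_seqs" "x' \<in> bounded_seqs" "y \<in> bounded_seqs" "y' \<in> bounded_seqs" "lim_dist x x' = 0" "lim_dist y y' = 0"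
  shows "lim_dist x y = lim_dist x' y'"
  using lim_dist_tri[OF assms(1,2,3)] lim_dist_tri[OF assms(2,1,3)] lim_dist_tri[OF assms(2,3,4)] lim_dist_tri[OF assms(2,4,3)]
    lim_dist_sym[OF assms(1,2)] lim_dist_sym[OF assms(3,4)] assms(5,6) by simp

lemma cone_dist: 
  assumes "x \<in> bounded_seqs" "y \<in> bounded_seqs" shows "acone_dist (cone_pt x) (cone_pt y) = lim_dist x y"
proof -
  have "acone_dist (cone_pt x) (cone_pt y) = lim_dist (rep (cone_pt x)) (rep (cone_pt y))"
    using cone_pt_in[OF assms(1)] cone_pt_in[OF assms(2)]
    by (simp add: asymptotic_cone_dist_def asymptotic_cone_def ultralimit_dist_def rep_def lim_dist_def)
  also have "\<dots> = lim_dist x y"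
    using assms rep cone_pt_in by (intro lim_dist_cong) (auto simp flip: cone_pt_eq_iff)
  finally show ?thesis .
qed

text \<open>The distances between bounded sequences are the distances between the points of the cone that
  they represent, so facts about the tree hold for them; working with sequences avoids choosing
  representatives.\<close>

lemma lim_dist_four_point:
  assumes "a \<in> bounded_seqs" "b \<in> bounded_seqs" "x \<in> bounded_seqs" "y \<in> bounded_seqs"
  shows "lim_dist a x + lim_dist b y \<le> max (lim_dist a b + lim_dist x y) (lim_dist a y + lim_dist b x)"
  using real_tree_four_point[OF tree cone_pt_in cone_pt_in cone_pt_in cone_pt_in, OF assms] assms by (simp add: cone_dist)

lemma lim_dist_geodesic:
  assumes "x \<in> bounded_seqs" "y \<in> bounded_seqs"
  shows "\<exists>\<gamma>. \<gamma> \<in> {0..lim_dist x y} \<rightarrow> bounded_seqs \<and> lim_dist (\<gamma> 0) x = 0 \<and> lim_dist (\<gamma> (lim_dist x y)) y = 0 \<and>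
    (\<forall>s\<in>{0..lim_dist x y}. \<forall>t\<in>{0..lim_dist x y}. lim_dist (\<gamma> s) (\<gamma> t) = \<bar>s - t\<bar>)"
proof -
  obtain c where "geodesic_path acone acone_dist (cone_pt x) (cone_pt y) c"
    using real_tree_geodesic[OF tree cone_pt_in cone_pt_in, OF assms] .
  then have c: "c \<in> {0..lim_dist x y} \<rightarrow> acone" "c 0 = cone_pt x" "c (lim_dist x y) = cone_pt y"
    "\<And>s t. \<lbrakk>s \<in> {0..lim_dist x y}; t \<in> {0..lim_dist x y}\<rbrakk> \<Longrightarrow> acone_dist (c s) (c t) = \<bar>s - t\<bar>"
    using assms by (auto simp: geodesic_path_def cone_dist)
  have c': "rep (c s) \<in> bounded_seqs" "cone_pt (rep (c s)) = c s" if "s \<in> {0..lim_dist x y}" for s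
    using rep[OF funcset_mem[OF c(1) that]] .
  have L: "0 \<in> {0..lim_dist x y}" "lim_dist x y \<in> {0..lim_dist x y}" using lim_dist_nonneg[OF assms] by auto
  show ?thesis
  proof (intro exI[of _ "\<lambda>s. rep (c s)"] conjI ballI)
    show "lim_dist (rep (c 0)) x = 0" "lim_dist (rep (c (lim_dist x y))) y = 0"
      using c'[OF L(1)] c'[OF L(2)] c(2,3) assms by (simp_all flip: cone_pt_eq_iff)
    show "lim_dist (rep (c s)) (rep (c t)) = \<bar>s - t\<bar>" if "s \<in> {0..lim_dist x y}" "t \<in> {0..lim_dist x y}" for s t
      using c(4)[OF that] c'[OF that(1)] c'[OF that(2)] cone_dist by metis
  qed (use c' in blast)
qed

text \<open>Homomorphisms \<open>\<theta> n\<close> that send every element to length \<open>O(r n)\<close> induce an action of \<open>G\<close> on the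
  cone, by left multiplication with \<open>\<theta> n g\<close> in the \<open>n\<close>-th coordinate.\<close>

lemma FR_limit_fixed_point:
  assumes FR: "property_FR G" and \<theta>: "\<And>n. \<theta> n \<in> hom G G"
    and bd: "\<And>g. g \<in> carrier G \<Longrightarrow> (\<lambda>n. \<theta> n g) \<in> bounded_seqs"
  obtains y where "y \<in> bounded_seqs" "\<And>g. g \<in> carrier G \<Longrightarrow> lim_dist y (\<lambda>n. \<theta> n g \<otimes> y n) = 0"
proof -
  define a where "a g A = cone_pt (\<lambda>n. \<theta> n g \<otimes> rep A n)" for g A
  have a: "a g (cone_pt x) = cone_pt (\<lambda>n. \<theta> n g \<otimes> x n)" if "g \<in> carrier G" "x \<in> bounded_seqs" for g x
    unfolding a_def using that rep[OF cone_pt_in[OF that(2)]] bd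
    by (subst cone_pt_eq_iff) (auto simp: lim_dist_left simp flip: cone_pt_eq_iff)
  have hom: "\<theta> n (g \<otimes> h) = \<theta> n g \<otimes> \<theta> n h" "\<theta> n \<one> = \<one>" if "g \<in> carrier G" "h \<in> carrier G" for n g h
  proof -
    interpret \<theta>: group_hom G G "\<theta> n" by unfold_locales (rule \<theta>)
    show "\<theta> n (g \<otimes> h) = \<theta> n g \<otimes> \<theta> n h" "\<theta> n \<one> = \<one>" using that by simp_all
  qed
  have one: "\<theta> n \<one> = \<one>" for n using hom(2)[OF one_closed one_closed] .
  let ?\<phi> = "\<lambda>g. \<lambda>A\<in>acone. a g A"
  have "group_action G acone ?\<phi>"
  proof (rule group_action_restrictI)
    show "a g A \<in> acone" if "g \<in> carrier G" "A \<in> acone" for g A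
      using that a bd cone_pt_in by (auto simp: cone_eq)
    show "a \<one> A = A" if "A \<in> acone" for A
      using that bounded_seqsD by (auto simp: cone_eq a one)
    show "a (g \<otimes> h) A = a g (a h A)" if "g \<in> carrier G" "h \<in> carrier G" "A \<in> acone" for g h A
    proof -
      obtain x where x: "x \<in> bounded_seqs" "A = cone_pt x" using \<open>A \<in> acone\<close> by (auto simp: cone_eq)
      show ?thesis
        using that x bd[OF that(2)] bounded_seqsD[OF x(1)] bounded_seqsD[OF bd[OF that(1)]] bounded_seqsD[OF bd[OF that(2)]]
        by (simp add: a hom(1) m_assoc)
    qed
  qed (rule group_axioms)
  moreover have "acone_dist (a g A) (a g B) = acone_dist A B" if "g \<in> carrier G" "A \<in> acone" "B \<in> acone" for g A B
    using that bd by (auto simp: cone_eq a cone_dist lim_dist_left)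
  ultimately have "isometric_action G acone acone_dist ?\<phi>" by (simp add: isometric_action_def)
  from property_FR_imp_FR_on_type[OF FR, unfolded FR_on_type_def, rule_format, OF conjI[OF tree this]]
  obtain A where "A \<in> acone" "\<forall>g\<in>carrier G. ?\<phi> g A = A" by blast
  then have A: "A \<in> acone" "\<And>g. g \<in> carrier G \<Longrightarrow> a g A = A" by auto
  then obtain y where y: "y \<in> bounded_seqs" "A = cone_pt y" by (auto simp: cone_eq)
  have "lim_dist y (\<lambda>n. \<theta> n g \<otimes> y n) = 0" if g: "g \<in> carrier G" for g
  proof -
    have "cone_pt y = cone_pt (\<lambda>n. \<theta> n g \<otimes> y n)" using A(2)[OF g] y a[OF g y(1)] by simp
    then show ?thesis using cone_pt_eq_iff y(1) bd[OF g] by blast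
  qed
  then show ?thesis using that y(1) by blast
qed

end


section \<open>Iterates of an endomorphism have bounded energy\<close>

context group
begin

definition "conj_by g x = g \<otimes> x \<otimes> inv g"

lemma conj_by_closed [simp, intro]: "\<lbrakk>g \<in> carrier G; x \<in> carrier G\<rbrakk> \<Longrightarrow> conj_by g x \<in> carrier G"
  by (simp add: conj_by_def)

lemma conj_by_conj_by: "\<lbrakk>g \<in> carrier G; h \<in> carrier G; x \<in> carrier G\<rbrakk> \<Longrightarrow> conj_by g (conj_by h x) = conj_by (g \<otimes> h) x"
  by (simp add: conj_by_def inv_mult_group m_assoc)

lemma conj_by_one [simp]: "x \<in> carrier G \<Longrightarrow> conj_by \<one> x = x"
  by (simp add: conj_by_def)

lemma conj_by_mult: "\<lbrakk>g \<in> carrier G; x \<in> carrier G; y \<in> carrier G\<rbrakk> \<Longrightarrow> conj_by g (x \<otimes> y) = conj_by g x \<otimes> conj_by g y"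
  by (simp add: conj_by_def m_assoc flip: m_assoc[of "inv g" g])

lemma conj_by_inv: "\<lbrakk>g \<in> carrier G; x \<in> carrier G\<rbrakk> \<Longrightarrow> conj_by g (inv x) = inv (conj_by g x)"
  by (simp add: conj_by_def inv_mult_group m_assoc)

lemma conj_by_inv_cancel: "\<lbrakk>g \<in> carrier G; x \<in> carrier G\<rbrakk> \<Longrightarrow> conj_by g (conj_by (inv g) x) = x"
  "\<lbrakk>g \<in> carrier G; x \<in> carrier G\<rbrakk> \<Longrightarrow> conj_by (inv g) (conj_by g x) = x"
  by (simp_all add: conj_by_conj_by)

lemma conj_by_eq_iff_commute: "\<lbrakk>g \<in> carrier G; x \<in> carrier G\<rbrakk> \<Longrightarrow> conj_by g x = x \<longleftrightarrow> g \<otimes> x = x \<otimes> g"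
  unfolding conj_by_def by (metis inv_closed m_assoc m_closed r_inv l_inv r_one)

lemma conj_by_hom: "\<lbrakk>\<theta> \<in> hom G G; g \<in> carrier G\<rbrakk> \<Longrightarrow> (\<lambda>x. conj_by g (\<theta> x)) \<in> hom G G"
  by (auto simp: hom_def conj_by_mult Pi_iff)

lemma hom_conj_by:
  assumes "\<theta> \<in> hom G G" "g \<in> carrier G" "x \<in> carrier G"
  shows "\<theta> (conj_by g x) = conj_by (\<theta> g) (\<theta> x)"
proof -
  interpret \<theta>: group_hom G G \<theta> by unfold_locales fact
  show ?thesis using assms by (simp add: conj_by_def)
qed

lemma hom_funpow: "\<theta> \<in> hom G G \<Longrightarrow> (\<theta> ^^ n) \<in> hom G G"
  by (induction n) (auto simp: hom_def Pi_iff)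

lemma hom_carrier: "\<lbrakk>\<theta> \<in> hom G G; x \<in> carrier G\<rbrakk> \<Longrightarrow> \<theta> x \<in> carrier G"
  by (auto simp: hom_def)

text \<open>From \<open>\<theta>\<^sup>n\<^sup>+\<^sup>p = g \<theta>\<^sup>n g\<inverse>\<close> one gets \<open>\<theta>\<^sup>n\<^sup>+\<^sup>j\<^sup>p = g\<^sup>j \<theta>\<^sup>n g\<^sup>-\<^sup>j\<close> for all \<open>j\<close>; a multiple \<open>q = j p\<close> of \<open>p\<close> that is at
  least \<open>n\<close> can then replace both \<open>n\<close> and \<open>p\<close>.\<close>

lemma eventually_inner_power:
  assumes \<theta>: "\<theta> \<in> hom G G" and g: "g \<in> carrier G" and "0 < p"
    and eq: "\<And>x. x \<in> carrier G \<Longrightarrow> (\<theta> ^^ (n + p)) x = conj_by g ((\<theta> ^^ n) x)"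
  shows "\<exists>q>0. \<exists>h\<in>carrier G. \<forall>x\<in>carrier G. (\<theta> ^^ q) ((\<theta> ^^ q) x) = conj_by h ((\<theta> ^^ q) x)"
proof -
  have pw: "(\<theta> ^^ i) x \<in> carrier G" if "x \<in> carrier G" for i x
    using hom_carrier[OF hom_funpow[OF \<theta>] that] .
  have it: "(\<theta> ^^ (n + j * p)) x = conj_by (g [^] j) ((\<theta> ^^ n) x)" if x: "x \<in> carrier G" for j x
    using x
  proof (induction j)
    case 0 then show ?case using pw by simp
  next
    case (Suc j)
    have "(\<theta> ^^ (n + Suc j * p)) x = (\<theta> ^^ (n + p + j * p)) x" by (simp add: algebra_simps)
    also have "\<dots> = conj_by g ((\<theta> ^^ n) ((\<theta> ^^ (j * p)) x))"
      using eq[OF pw[OF x]] by (simp add: funpow_add)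
    also have "(\<theta> ^^ n) ((\<theta> ^^ (j * p)) x) = conj_by (g [^] j) ((\<theta> ^^ n) x)"
      using Suc by (simp add: funpow_add)
    also have "conj_by g \<dots> = conj_by (g [^] Suc j) ((\<theta> ^^ n) x)"
      using g pw[OF x] nat_pow_Suc2[OF g, of j] by (simp add: conj_by_conj_by)
    finally show ?case .
  qed
  define q where "q = Suc n * p"
  have "n \<le> q" using \<open>0 < p\<close> by (cases p) (auto simp: q_def)
  have "(\<theta> ^^ q) ((\<theta> ^^ q) x) = conj_by (g [^] Suc n) ((\<theta> ^^ q) x)" if x: "x \<in> carrier G" for x
  proof -
    have add: "(\<theta> ^^ i) ((\<theta> ^^ j) x) = (\<theta> ^^ (i + j)) x" for i j
      by (simp add: funpow_add)
    have "q + q = (n + q) + (q - n)" "n + (q - n) = q" using \<open>n \<le> q\<close> by simp_all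
    then have "(\<theta> ^^ q) ((\<theta> ^^ q) x) = (\<theta> ^^ (n + q)) ((\<theta> ^^ (q - n)) x)"
      by (simp only: add)
    also have "\<dots> = conj_by (g [^] Suc n) ((\<theta> ^^ n) ((\<theta> ^^ (q - n)) x))"
      using it[OF pw[OF x], of "Suc n"] unfolding q_def .
    finally show ?thesis using \<open>n + (q - n) = q\<close> by (simp only: add)
  qed
  moreover have "0 < q" using \<open>0 < p\<close> by (simp add: q_def)
  ultimately show ?thesis using g by blast
qed

end

context word_metric
begin

lemma hom_letter_bound:
  obtains C where "\<And>s. s \<in> S \<Longrightarrow> len (\<theta> s) \<le> C"
  using finite_imageI[OF finS, of "\<lambda>s. len (\<theta> s)"] unfolding finite_nat_set_iff_bounded_le by auto

lemma hom_eqI: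
  assumes "\<theta> \<in> hom G G" "\<theta>' \<in> hom G G" "\<And>s. s \<in> S \<Longrightarrow> \<theta> s = \<theta>' s" "x \<in> carrier G"
  shows "\<theta> x = \<theta>' x"
proof -
  interpret \<theta>: group_hom G G \<theta> by unfold_locales fact
  interpret \<theta>': group_hom G G \<theta>' by unfold_locales fact
  show ?thesis using assms(4)
  proof (induction x rule: word_length_induct)
    case (letter a x)
    then have "\<theta> a = \<theta>' a" using assms(3) S_carrier by auto
    then show ?case using letter letters_carrier[OF letter(1)] by simp
  qed simp
qed

lemma len_conj_by_le: "\<lbrakk>g \<in> carrier G; x \<in> carrier G\<rbrakk> \<Longrightarrow> len (conj_by g x) \<le> len x + 2 * len g"
  using len_mult3[of g x "inv g"] by (simp add: conj_by_def len_inv)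

lemma len_conj_by_ge: "\<lbrakk>g \<in> carrier G; x \<in> carrier G\<rbrakk> \<Longrightarrow> len x \<le> len (conj_by g x) + 2 * len g"
  using len_conj_by_le[of "inv g" "conj_by g x"] by (simp add: conj_by_inv_cancel len_inv)

end

context tree_cone
begin

text \<open>If the energy is unbounded, take for each \<open>k\<close> the first iterate of energy more than \<open>r k\<close>.  It is
  also at most a constant times \<open>r k\<close>, because the energy of the previous iterate is at most \<open>r k\<close>.
  So the conjugates of these iterates that nearly attain the minimum act on the cone.  A fixed point
  of this action amounts to conjugators that bring the energy down to \<open>o(r k)\<close>, a contradiction.\<close>

lemma FR_bounded_energy:
  assumes FR: "property_FR G" and \<phi>: "\<phi> \<in> hom G G"
  shows "\<exists>B. \<forall>n. \<exists>x\<in>carrier G. \<forall>s\<in>S. len (conj_by x ((\<phi> ^^ n) s)) \<le> B"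
proof (rule ccontr)
  assume unb: "\<not> ?thesis"
  define short where "short n B \<longleftrightarrow> (\<exists>x\<in>carrier G. \<forall>s\<in>S. len (conj_by x ((\<phi> ^^ n) s)) \<le> B)" for n B
  have unb: "\<exists>n. \<not> short n B" for B using unb by (auto simp: short_def)
  note pw = hom_funpow[OF \<phi>]
  obtain C where C: "\<And>s. s \<in> S \<Longrightarrow> len (\<phi> s) \<le> C" using hom_letter_bound[of \<phi>] by blast
  have step: "short (Suc n) (B * C)" if short: "short n B" for n B
  proof -
    obtain x where x: "x \<in> carrier G" "\<And>s. s \<in> S \<Longrightarrow> len (conj_by x ((\<phi> ^^ n) s)) \<le> B"
      using short by (auto simp: short_def)
    have "len (conj_by x ((\<phi> ^^ Suc n) s)) \<le> B * C" if s: "s \<in> S" for s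
    proof -
      have "len (conj_by x ((\<phi> ^^ n) (\<phi> s))) \<le> B * len (\<phi> s)"
        by (rule len_hom_le[OF conj_by_hom[OF pw x(1)] x(2)]) (use \<phi> S_carrier[OF s] hom_carrier in auto)
      also have "\<dots> \<le> B * C" using C[OF s] by simp
      finally show ?thesis by (simp add: funpow_swap1)
    qed
    then show ?thesis using x(1) by (auto simp: short_def)
  qed
  \<comment> \<open>\<open>short n B\<close> speaks of natural numbers \<open>B\<close>, so the scale is rounded down.\<close>
  define R where "R k = nat \<lfloor>r k\<rfloor>" for k
  have R: "real (R k) \<le> r k" for k using r_pos[of k] by (simp add: R_def)
  define N where "N k = (LEAST n. \<not> short n (R k))" for k
  have N: "\<not> short (N k) (R k)" for k unfolding N_def using unb[of "R k"] by (rule LeastI_ex)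
  have "short (N k) (R k * C + 1)" for k
  proof (cases "N k")
    case 0
    \<comment> \<open>The summand \<open>1\<close> covers the identity, which has energy at most \<open>1\<close>.\<close>
    have "short 0 1" unfolding short_def
      using len_letter S_carrier by (intro bexI[of _ \<one>]) auto
    then show ?thesis using 0 unfolding short_def by (auto intro: order_trans)
  next
    case (Suc n)
    then have "short n (R k)" using not_less_Least[of n "\<lambda>n. \<not> short n (R k)"] by (simp add: N_def)
    from step[OF this] show ?thesis unfolding Suc short_def by (meson order_trans le_add1)
  qed
  then obtain x where x: "x k \<in> carrier G" "\<And>s. s \<in> S \<Longrightarrow> len (conj_by (x k) ((\<phi> ^^ N k) s)) \<le> R k * C + 1" for k
    unfolding short_def by metis
  define \<theta> where "\<theta> k g = conj_by (x k) ((\<phi> ^^ N k) g)" for k g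
  have \<theta>: "\<theta> k \<in> hom G G" for k unfolding \<theta>_def by (rule conj_by_hom[OF pw x(1)])
  have bd: "(\<lambda>k. \<theta> k g) \<in> bounded_seqs" if g: "g \<in> carrier G" for g
  proof (rule bounded_seqsI)
    show "\<theta> k g \<in> carrier G" for k by (rule hom_carrier[OF \<theta> g])
    show "\<forall>\<^sub>F k in \<omega>. len (\<theta> k g) \<le> ((real C + 1) * len g) * r k"
      using eventually_r_ge[of 1]
    proof eventually_elim
      case (elim k)
      have "len (\<theta> k g) \<le> (R k * C + 1) * len g"
        by (rule len_hom_le[OF \<theta> _ g]) (use x(2) in \<open>simp add: \<theta>_def\<close>)
      then have "real (len (\<theta> k g)) \<le> real ((R k * C + 1) * len g)" by (rule of_nat_mono)
      also have "\<dots> = (real (R k) * C + 1) * len g" by (simp add: algebra_simps)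
      also have "\<dots> \<le> (r k * C + r k) * len g"
        using R[of k] elim by (intro mult_right_mono add_mono) auto
      finally show ?case by (simp add: algebra_simps)
    qed
  qed
  from FR_limit_fixed_point[OF FR \<theta> bd]
  obtain y where y: "y \<in> bounded_seqs" "\<And>g. g \<in> carrier G \<Longrightarrow> lim_dist y (\<lambda>k. \<theta> k g \<otimes> y k) = 0" by blast
  have "\<forall>\<^sub>F k in \<omega>. len (conj_by (inv (y k)) (\<theta> k s)) \<le> R k" if s: "s \<in> S" for s
  proof -
    note sG = S_carrier[OF s]
    have "((\<lambda>k. wd (y k) (\<theta> k s \<otimes> y k) / r k) \<longlongrightarrow> 0) \<omega>"
      using lim_dist_tendsto[OF y(1) bounded_seqs_mult[OF bd[OF sG] y(1)]] y(2)[OF sG] by simp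
    then have "\<forall>\<^sub>F k in \<omega>. wd (y k) (\<theta> k s \<otimes> y k) / r k < 1" by (rule order_tendstoD) simp
    then show ?thesis
    proof eventually_elim
      case (elim k)
      have "conj_by (inv (y k)) (\<theta> k s) = inv (y k) \<otimes> (\<theta> k s \<otimes> y k)"
        using bounded_seqsD[OF y(1)] bounded_seqsD[OF bd[OF sG]] by (simp add: conj_by_def m_assoc)
      then have "len (conj_by (inv (y k)) (\<theta> k s)) \<le> r k"
        using elim r_pos[of k] by (simp add: word_dist_def)
      then show ?case by (simp add: R_def le_nat_iff le_floor_iff)
    qed
  qed
  then have "\<forall>\<^sub>F k in \<omega>. \<forall>s\<in>S. len (conj_by (inv (y k)) (\<theta> k s)) \<le> R k"
    by (rule eventually_ball_finite[OF finS, rule_format])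
  then obtain k where k: "\<And>s. s \<in> S \<Longrightarrow> len (conj_by (inv (y k)) (\<theta> k s)) \<le> R k"
    using eventually_happens'[OF omega_nontrivial] by blast
  have "conj_by (inv (y k)) (\<theta> k s) = conj_by (inv (y k) \<otimes> x k) ((\<phi> ^^ N k) s)" if "s \<in> S" for s
    unfolding \<theta>_def using bounded_seqsD[OF y(1)] x(1) hom_carrier[OF pw S_carrier[OF that]] by (simp add: conj_by_conj_by)
  then have "short (N k) (R k)"
    unfolding short_def using k bounded_seqsD[OF y(1)] x(1) by (intro bexI[of _ "inv (y k) \<otimes> x k"]) auto
  then show False using N by blast
qed

text \<open>After conjugation the iterates map \<open>S\<close> into a fixed finite ball, so by the pigeonhole principle
  two of them agree on \<open>S\<close>.\<close>

lemma FR_conjugate_powers: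
  assumes FR: "property_FR G" and \<phi>: "\<phi> \<in> hom G G"
  shows "\<exists>n p. 0 < p \<and> (\<exists>g\<in>carrier G. \<forall>x\<in>carrier G. (\<phi> ^^ (n + p)) x = conj_by g ((\<phi> ^^ n) x))"
proof -
  note pw = hom_funpow[OF \<phi>]
  obtain B where "\<forall>n. \<exists>x\<in>carrier G. \<forall>s\<in>S. len (conj_by x ((\<phi> ^^ n) s)) \<le> B"
    using FR_bounded_energy[OF assms] ..
  then obtain x where x: "x n \<in> carrier G" "\<And>s. s \<in> S \<Longrightarrow> len (conj_by (x n) ((\<phi> ^^ n) s)) \<le> B" for n
    by metis
  define F where "F n = (\<lambda>s\<in>S. conj_by (x n) ((\<phi> ^^ n) s))" for n
  have "range F \<subseteq> PiE S (\<lambda>_. {g \<in> carrier G. len g \<le> B})"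
    using x hom_carrier[OF pw S_carrier] by (auto simp: F_def)
  then have "finite (range F)"
    by (rule finite_subset[OF _ finite_PiE[OF finS finite_ball]])
  then have "\<not> inj F" using finite_imageD[of F UNIV] infinite_UNIV_nat by auto
  then obtain i j where ij: "F i = F j" "i < j" by (metis injI linorder_neqE_nat)
  have "conj_by (x i) ((\<phi> ^^ i) z) = conj_by (x j) ((\<phi> ^^ j) z)" if "z \<in> carrier G" for z
  proof (rule hom_eqI[OF conj_by_hom[OF pw x(1)] conj_by_hom[OF pw x(1)] _ that])
    fix s assume "s \<in> S"
    then show "conj_by (x i) ((\<phi> ^^ i) s) = conj_by (x j) ((\<phi> ^^ j) s)" using fun_cong[OF ij(1), of s] by (simp add: F_def)
  qed
  then have "(\<phi> ^^ j) z = conj_by (inv (x j) \<otimes> x i) ((\<phi> ^^ i) z)" if "z \<in> carrier G" for z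
    using that x(1) hom_carrier[OF pw that] by (simp flip: conj_by_conj_by) (simp add: conj_by_inv_cancel)
  then show ?thesis
    using ij(2) x(1) by (intro exI[of _ i] exI[of _ "j - i"] conjI bexI[of _ "inv (x j) \<otimes> x i"]) auto
qed

end


section \<open>Endomorphisms that are inner on their image\<close>

context tree_cone
begin

lemma hom_on_bounded_seqs:
  assumes \<theta>: "\<theta> \<in> hom G G" and C: "\<And>s. s \<in> S \<Longrightarrow> len (\<theta> s) \<le> C" and "x \<in> bounded_seqs"
  shows bounded_seqs_hom: "(\<lambda>k. \<theta> (x k)) \<in> bounded_seqs"
    and lim_dist_hom_le: "y \<in> bounded_seqs \<Longrightarrow> lim_dist (\<lambda>k. \<theta> (x k)) (\<lambda>k. \<theta> (y k)) \<le> C * lim_dist x y"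
proof -
  interpret \<theta>: group_hom G G \<theta> by unfold_locales fact
  have le: "real (len (\<theta> g)) \<le> C * real (len g)" if "g \<in> carrier G" for g
    using len_hom_le[OF \<theta> C that] by (simp flip: of_nat_mult)
  have bs: "(\<lambda>k. \<theta> (x k)) \<in> bounded_seqs" if "x \<in> bounded_seqs" for x
  proof -
    obtain B where "\<forall>\<^sub>F k in \<omega>. len (x k) \<le> B * r k" using \<open>x \<in> bounded_seqs\<close> by (auto simp: bounded_seqs_def)
    then have "\<forall>\<^sub>F k in \<omega>. len (\<theta> (x k)) \<le> (C * B) * r k"
    proof eventually_elim
      case (elim k)
      have "len (\<theta> (x k)) \<le> C * (B * r k)"
        using order_trans[OF le[OF bounded_seqsD[OF that]] mult_left_mono[OF elim]] by simp
      then show ?case by (simp add: mult.assoc)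
    qed
    then show ?thesis using bounded_seqsD[OF that] by (intro bounded_seqsI) auto
  qed
  then show "(\<lambda>k. \<theta> (x k)) \<in> bounded_seqs" using assms(3) .
  show "lim_dist (\<lambda>k. \<theta> (x k)) (\<lambda>k. \<theta> (y k)) \<le> C * lim_dist x y" if y: "y \<in> bounded_seqs"
  proof (rule tendsto_le[OF omega_nontrivial tendsto_mult[OF tendsto_const lim_dist_tendsto[OF assms(3) y]] lim_dist_tendsto[OF bs bs, OF assms(3) y]])
    have "wd (\<theta> (x k)) (\<theta> (y k)) \<le> C * wd (x k) (y k)" for k
      using le[of "inv (x k) \<otimes> y k"] bounded_seqsD[OF assms(3), of k] bounded_seqsD[OF y, of k] by (simp add: word_dist_def)
    then show "\<forall>\<^sub>F k in \<omega>. wd (\<theta> (x k)) (\<theta> (y k)) / r k \<le> C * (wd (x k) (y k) / r k)"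
      using less_imp_le[OF r_pos] by (intro always_eventually allI) (simp add: divide_right_mono)
  qed
qed

text \<open>Elements \<open>\<Psi> u\<close> commute with \<open>z\<close>, so \<open>z\<close> moves all points represented by sequences in the image
  of \<open>\<Psi>\<close> by the same distance.  The image of a geodesic under \<open>\<Psi>\<close> is a Lipschitz path of such
  points, and \<open>x\<close> guarantees that it is not constant.\<close>

lemma commuting_displacement_translation:
  assumes \<Psi>: "\<Psi> \<in> hom G G" and z: "z \<in> bounded_seqs"
    and comm: "\<And>k u. u \<in> carrier G \<Longrightarrow> z k \<otimes> \<Psi> u = \<Psi> u \<otimes> z k"
    and x: "x \<in> bounded_seqs" "0 < lim_dist (\<lambda>k. \<one>) (\<lambda>k. \<Psi> (x k))"
    and pos: "0 < lim_dist (\<lambda>k. \<one>) z"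
  shows "lim_dist (\<lambda>k. \<one>) (\<lambda>k. z k \<otimes> z k) = 2 * lim_dist (\<lambda>k. \<one>) z"
proof -
  interpret \<Psi>: group_hom G G \<Psi> by unfold_locales fact
  obtain C where C: "\<And>s. s \<in> S \<Longrightarrow> len (\<Psi> s) \<le> C" using hom_letter_bound[of \<Psi>] by blast
  let ?o = "\<lambda>k::nat. \<one>"
  have o: "?o \<in> bounded_seqs" by simp
  obtain \<gamma> where \<gamma>: "\<gamma> \<in> {0..lim_dist ?o x} \<rightarrow> bounded_seqs" "lim_dist (\<gamma> 0) ?o = 0" "lim_dist (\<gamma> (lim_dist ?o x)) x = 0"
    "\<And>s t. \<lbrakk>s \<in> {0..lim_dist ?o x}; t \<in> {0..lim_dist ?o x}\<rbrakk> \<Longrightarrow> lim_dist (\<gamma> s) (\<gamma> t) = \<bar>s - t\<bar>"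
    using lim_dist_geodesic[OF o x(1)] by metis
  define L where "L = lim_dist ?o x"
  define \<eta> where "\<eta> s = (\<lambda>k. \<Psi> (\<gamma> s k))" for s
  note \<gamma> = \<gamma>[folded L_def]
  have L: "0 \<le> L" unfolding L_def by (rule lim_dist_nonneg[OF o x(1)])
  then have L01: "0 \<in> {0..L}" "L \<in> {0..L}" by auto
  have \<gamma>b: "\<gamma> s \<in> bounded_seqs" if "s \<in> {0..L}" for s using \<gamma>(1) that by blast
  have \<eta>b: "\<eta> s \<in> bounded_seqs" if "s \<in> {0..L}" for s unfolding \<eta>_def by (rule bounded_seqs_hom[OF \<Psi> C \<gamma>b[OF that]])
  have \<Psi>x: "(\<lambda>k. \<Psi> (x k)) \<in> bounded_seqs" by (rule bounded_seqs_hom[OF \<Psi> C x(1)])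
  have "lim_dist (\<eta> 0) (\<lambda>k. \<Psi> \<one>) \<le> C * lim_dist (\<gamma> 0) ?o"
    unfolding \<eta>_def by (rule lim_dist_hom_le[OF \<Psi> C \<gamma>b[OF L01(1)] o])
  moreover have "lim_dist (\<eta> L) (\<lambda>k. \<Psi> (x k)) \<le> C * lim_dist (\<gamma> L) x"
    unfolding \<eta>_def by (rule lim_dist_hom_le[OF \<Psi> C \<gamma>b[OF L01(2)] x(1)])
  ultimately have ends: "lim_dist (\<eta> 0) ?o = 0" "lim_dist (\<eta> L) (\<lambda>k. \<Psi> (x k)) = 0"
    using \<gamma>(2,3) lim_dist_nonneg[OF \<eta>b[OF L01(1)] o] lim_dist_nonneg[OF \<eta>b[OF L01(2)] \<Psi>x] by simp_all
  have ne: "0 < lim_dist (\<eta> 0) (\<eta> L)"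
    using x(2) lim_dist_cong[OF \<eta>b[OF L01(1)] o \<eta>b[OF L01(2)] \<Psi>x ends] by simp
  have disp: "lim_dist u (\<lambda>k. w k \<otimes> u k) = lim_dist ?o w"
    if "u \<in> bounded_seqs" "w \<in> bounded_seqs" "\<And>k. w k \<otimes> u k = u k \<otimes> w k" for u w
    using lim_dist_left[OF that(1) o that(2)] bounded_seqsD[OF that(1)] that(3) by simp
  let ?Z = "\<lambda>u k. z k \<otimes> u k"
  have "\<exists>s\<in>{0..L}. lim_dist (\<eta> s) (?Z (?Z (\<eta> s))) = 2 * lim_dist ?o z"
  proof (rule constant_displacement_translation[where P = bounded_seqs and D = lim_dist and Z = ?Z and \<eta> = \<eta> and L = L and C = "real C"])
    show "?Z \<in> bounded_seqs \<rightarrow> bounded_seqs" using z by auto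
    show "lim_dist (?Z u) (?Z v) = lim_dist u v" if "u \<in> bounded_seqs" "v \<in> bounded_seqs" for u v using lim_dist_left[OF z that] .
    show "\<eta> \<in> {0..L} \<rightarrow> bounded_seqs" using \<eta>b by auto
    show "lim_dist (\<eta> s) (\<eta> t) \<le> real C * \<bar>s - t\<bar>" if "s \<in> {0..L}" "t \<in> {0..L}" for s t :: real
      using lim_dist_hom_le[OF \<Psi> C \<gamma>b[OF that(1)] \<gamma>b[OF that(2)]] \<gamma>(4)[OF that] by (simp add: \<eta>_def)
    show "lim_dist (\<eta> s) (?Z (\<eta> s)) = lim_dist ?o z" if "s \<in> {0..L}" for s
      by (rule disp[OF \<eta>b[OF that] z]) (use comm bounded_seqsD[OF \<gamma>b[OF that]] in \<open>simp add: \<eta>_def\<close>)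
  qed (use L ne pos in \<open>auto intro: lim_dist_sym lim_dist_refl lim_dist_tri lim_dist_four_point\<close>)
  then obtain s where s: "s \<in> {0..L}" "lim_dist (\<eta> s) (?Z (?Z (\<eta> s))) = 2 * lim_dist ?o z" by blast
  have "z k \<otimes> z k \<otimes> \<eta> s k = \<eta> s k \<otimes> (z k \<otimes> z k)" for k
    using comm[OF bounded_seqsD[OF \<gamma>b[OF s(1)]], of k] bounded_seqsD[OF z, of k] bounded_seqsD[OF \<eta>b[OF s(1)], of k]
    unfolding \<eta>_def by (metis m_assoc)
  then have "lim_dist (\<eta> s) (\<lambda>k. (z k \<otimes> z k) \<otimes> \<eta> s k) = lim_dist ?o (\<lambda>k. z k \<otimes> z k)"
    by (intro disp \<eta>b s(1)) (use z in auto)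
  moreover have "(\<lambda>k. (z k \<otimes> z k) \<otimes> \<eta> s k) = ?Z (?Z (\<eta> s))"
    using bounded_seqsD[OF z] bounded_seqsD[OF \<eta>b[OF s(1)]] by (simp add: m_assoc)
  ultimately show ?thesis using s(2) by simp
qed

text \<open>Here \<open>z\<close> translates by \<open>1\<close> along a line through the base point \<open>o\<close>.  An element \<open>w\<close> commuting with
  \<open>z\<close> for which the conclusion fails at all scales would represent a point at distance \<open>1\<close> from \<open>o\<close>
  and at distance at least \<open>1\<close> from the points \<open>z o\<close> and \<open>z\<inverse> o\<close>.  The four-point condition for \<open>o\<close>,
  \<open>z o\<close>, \<open>w\<close>, \<open>z w\<close> turns the latter into equalities, and then both \<open>o\<close> and \<open>w\<close> are midpoints between
  \<open>z\<inverse> o\<close> and \<open>z o\<close>, which is impossible in a tree.\<close>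

lemma shortening_by_commuting_element:
  assumes z: "z \<in> bounded_seqs" "lim_dist (\<lambda>k. \<one>) z = 1" "lim_dist (\<lambda>k. \<one>) (\<lambda>k. z k \<otimes> z k) = 2"
    and P: "\<And>k w. P k w \<Longrightarrow> w \<in> carrier G \<and> w \<otimes> z k = z k \<otimes> w"
  shows "\<exists>k. \<forall>w. P k w \<and> len w \<le> r k + K \<longrightarrow>
           len w \<le> r k \<or> len (w \<otimes> z k) \<le> r k \<or> len (w \<otimes> inv (z k)) \<le> r k"
proof (rule ccontr)
  assume "\<not> ?thesis"
  then obtain w where w0: "\<And>k. P k (w k)" "\<And>k. len (w k) \<le> r k + K" "\<And>k. \<not> len (w k) \<le> r k"
    "\<And>k. \<not> len (w k \<otimes> z k) \<le> r k" "\<And>k. \<not> len (w k \<otimes> inv (z k)) \<le> r k"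
    by metis
  have w: "w k \<in> carrier G" "w k \<otimes> z k = z k \<otimes> w k" "len (w k) \<le> r k + K" "r k < len (w k)"
    "r k < len (w k \<otimes> z k)" "r k < len (w k \<otimes> inv (z k))" for k
    using P[OF w0(1)] w0(2-5)[unfolded not_le] by blast+
  let ?o = "\<lambda>k::nat. \<one>" and ?z' = "\<lambda>k. inv (z k)" and ?zw = "\<lambda>k. z k \<otimes> w k"
  note zc = bounded_seqsD[OF z(1)]
  have bs: "?o \<in> bounded_seqs" "z \<in> bounded_seqs" "?z' \<in> bounded_seqs" using z by auto
  have wb: "w \<in> bounded_seqs"
  proof (rule bounded_seqsI[where C = 2])
    show "\<forall>\<^sub>F k in \<omega>. len (w k) \<le> 2 * r k"
      using eventually_r_ge[of K] by eventually_elim (use w(3) in \<open>smt (verit)\<close>)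
  qed (rule w)
  then have zwb: "?zw \<in> bounded_seqs" using bs by auto
  have w': "w k \<otimes> inv (z k) = inv (z k) \<otimes> w k" for k
  proof -
    have "inv (z k) \<otimes> (w k \<otimes> z k) \<otimes> inv (z k) = inv (z k) \<otimes> (z k \<otimes> w k) \<otimes> inv (z k)" using w(2) by simp
    then show ?thesis using zc[of k] w(1)[of k] by (simp add: m_assoc flip: m_assoc[of "inv (z k)" "z k"])
  qed
  have 1: "lim_dist ?o w = 1"
  proof (rule antisym)
    show "lim_dist ?o w \<le> 1" by (rule lim_dist_leI[where K = K]) (use bs wb w in \<open>auto simp: wd_one\<close>)
    show "1 \<le> lim_dist ?o w" by (rule lim_dist_geI) (use bs wb w(1,4) in \<open>auto simp: wd_one intro!: always_eventually less_imp_le\<close>)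
  qed
  have 2: "lim_dist ?o ?z' = 1"
    using z(2) zc unfolding lim_dist_def by (simp add: wd_one len_inv)
  have 3: "lim_dist ?z' z = 2"
    using z(3) zc unfolding lim_dist_def by (simp add: word_dist_def)
  have 4: "lim_dist w ?zw = 1"
    using lim_dist_left[OF wb bs(1) z(1)] z(2) w(1,2) by simp
  have 5: "lim_dist z ?zw = 1" using lim_dist_left[OF z(1) bs(1) wb] zc 1 by simp
  have 6: "lim_dist ?o ?zw = lim_dist ?z' w"
    using zc w(1) unfolding lim_dist_def by (simp add: word_dist_def)
  have 7: "1 \<le> lim_dist ?z' w"
    by (rule lim_dist_geI[OF bs(3) wb]) (use w(1,2,5) zc in \<open>auto simp: word_dist_def intro!: always_eventually less_imp_le\<close>)
  have 8: "1 \<le> lim_dist z w"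
    by (rule lim_dist_geI[OF bs(2) wb]) (use w(1,6) w' zc in \<open>auto simp: word_dist_def intro!: always_eventually less_imp_le\<close>)
  have "lim_dist ?o ?zw + lim_dist z w \<le> 2"
    using lim_dist_four_point[OF bs(1,2) zwb wb] z(2) lim_dist_sym[OF zwb wb] 4 5 1 by simp
  then have 9: "lim_dist ?z' w = 1" "lim_dist z w = 1" using 6 7 8 by simp_all
  show False
    using lim_dist_four_point[OF bs(3) bs(1) bs(2) wb] 1 2 3 9 z(2) lim_dist_sym[OF bs(3,1)] by simp
qed

text \<open>Building an element of \<open>\<Psi>(G)\<close> letter by letter and shortening by \<open>z k\<close> after each letter shows that
  \<open>\<Psi>(G)\<close> is contained in finitely many cosets of \<open>\<langle>z k\<rangle>\<close>, for a single suitable \<open>k\<close>.\<close>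

lemma no_displacing_centralizer:
  assumes FR: "property_FR G" and \<Psi>: "\<Psi> \<in> hom G G" and inf: "infinite (\<Psi> ` carrier G)"
    and x: "x \<in> bounded_seqs" "0 < lim_dist (\<lambda>k. \<one>) (\<lambda>k. \<Psi> (x k))"
    and z: "\<And>k. z k \<in> carrier G" "\<And>k. r k \<le> len (z k)" "\<And>k. len (z k) \<le> r k + K"
    and comm: "\<And>k u. u \<in> carrier G \<Longrightarrow> z k \<otimes> \<Psi> u = \<Psi> u \<otimes> z k"
  shows False
proof -
  interpret \<Psi>: group_hom G G \<Psi> by unfold_locales fact
  obtain C where C: "\<And>s. s \<in> S \<Longrightarrow> len (\<Psi> s) \<le> C" using hom_letter_bound[of \<Psi>] by blast
  let ?o = "\<lambda>k::nat. \<one>"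
  have zb: "z \<in> bounded_seqs"
  proof (rule bounded_seqsI[where C = 2])
    show "\<forall>\<^sub>F k in \<omega>. len (z k) \<le> 2 * r k"
      using eventually_r_ge[of K] by eventually_elim (use z(3) in \<open>smt (verit)\<close>)
  qed (rule z)
  have D1: "lim_dist ?o z = 1"
  proof (rule antisym)
    show "lim_dist ?o z \<le> 1" by (rule lim_dist_leI[where K = K]) (use zb z in \<open>auto simp: wd_one\<close>)
    show "1 \<le> lim_dist ?o z" by (rule lim_dist_geI) (use zb z in \<open>auto simp: wd_one\<close>)
  qed
  have D2: "lim_dist ?o (\<lambda>k. z k \<otimes> z k) = 2"
    using commuting_displacement_translation[OF \<Psi> zb comm x] D1 by simp
  define P where "P k w \<longleftrightarrow> (\<exists>u\<in>carrier G. \<exists>m::int. w = \<Psi> u \<otimes> z k [^] m)" for k w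
  have PD: "w \<in> carrier G \<and> w \<otimes> z k = z k \<otimes> w" if Pw: "P k w" for k w
  proof -
    obtain u and m :: int where u: "u \<in> carrier G" "w = \<Psi> u \<otimes> z k [^] m" using Pw by (auto simp: P_def)
    have zz: "z k [^] m \<otimes> z k = z k \<otimes> z k [^] m"
      using int_pow_mult[OF z(1), of k m 1] int_pow_mult[OF z(1), of k 1 m] z(1)[of k] by (simp add: add.commute)
    have "w \<otimes> z k = \<Psi> u \<otimes> (z k \<otimes> z k [^] m)" using u z(1)[of k] zz by (simp add: m_assoc)
    also have "\<dots> = (z k \<otimes> \<Psi> u) \<otimes> z k [^] m" using u z(1)[of k] comm[OF u(1), of k] by (simp add: m_assoc)
    finally show ?thesis using u z(1)[of k] by (simp add: m_assoc)
  qed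
  from shortening_by_commuting_element[OF zb D1 D2 PD] obtain k where
    k: "\<And>w. \<lbrakk>P k w; len w \<le> r k + real C\<rbrakk> \<Longrightarrow>
          len w \<le> r k \<or> len (w \<otimes> z k) \<le> r k \<or> len (w \<otimes> inv (z k)) \<le> r k"
    by blast
  define c where "c = z k"
  have c: "c \<in> carrier G" unfolding c_def by (rule z)
  have red: "\<exists>m::int. len (\<Psi> u \<otimes> c [^] m) \<le> r k" if "u \<in> carrier G" for u
    using that
  proof (induction u rule: word_length_induct)
    case one
    show ?case using r_pos[of k] by (intro exI[of _ 0]) (simp add: len_one)
  next
    case (letter a u)
    then obtain m where m: "len (\<Psi> u \<otimes> c [^] (m::int)) \<le> r k" by blast
    note a = letters_carrier[OF letter(1)]
    let ?w = "\<Psi> (a \<otimes> u) \<otimes> c [^] m"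
    have w: "?w = \<Psi> a \<otimes> (\<Psi> u \<otimes> c [^] m)" using a letter(2) c by (simp add: m_assoc)
    have "len ?w \<le> len (\<Psi> a) + len (\<Psi> u \<otimes> c [^] m)"
      unfolding w using a letter(2) c by (intro len_mult) auto
    then have "len ?w \<le> r k + real C" using m len_hom_letter[OF \<Psi> C letter(1)] by linarith
    moreover have "P k ?w" unfolding P_def c_def using a letter(2) by blast
    ultimately have "len ?w \<le> r k \<or> len (?w \<otimes> c) \<le> r k \<or> len (?w \<otimes> inv c) \<le> r k"
      using k unfolding c_def by blast
    moreover have "?w \<otimes> c = \<Psi> (a \<otimes> u) \<otimes> c [^] (m + 1)" "?w \<otimes> inv c = \<Psi> (a \<otimes> u) \<otimes> c [^] (m - 1)"
      using a letter(2) c by (simp_all add: m_assoc int_pow_mult int_pow_diff)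
    ultimately show ?case by metis
  qed
  have sub: "subgroup (\<Psi> ` carrier G) G" by (rule \<Psi>.img_is_subgroup)
  obtain f h where f: "\<And>x y. \<lbrakk>x \<in> \<Psi> ` carrier G; y \<in> \<Psi> ` carrier G\<rbrakk> \<Longrightarrow> f (x \<otimes> y) = f x + (f y :: int)"
    and h: "h \<in> \<Psi> ` carrier G" "f h \<noteq> 0"
  proof (rule commuting_coset_transfer[OF sub inf c])
    show "finite {g \<in> carrier G. len g \<le> nat \<lfloor>r k\<rfloor>}" by (rule finite_ball)
    show "h \<otimes> c = c \<otimes> h" if "h \<in> \<Psi> ` carrier G" for h using that comm by (auto simp: c_def)
    show "\<exists>m::int. h \<otimes> c [^] m \<in> {g \<in> carrier G. len g \<le> nat \<lfloor>r k\<rfloor>}" if h: "h \<in> \<Psi> ` carrier G" for h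
    proof -
      obtain u where u: "u \<in> carrier G" "h = \<Psi> u" using h by blast
      obtain m where "len (\<Psi> u \<otimes> c [^] (m::int)) \<le> r k" using red[OF u(1)] by blast
      then show ?thesis using u c by (intro exI[of _ m]) (simp add: le_nat_iff le_floor_iff)
    qed
  qed blast
  obtain u where u: "u \<in> carrier G" "h = \<Psi> u" using h(1) by blast
  have "f (\<Psi> u) = 0"
    by (rule FR_hom_int_trivial[OF group_axioms FR _ u(1), where f = "\<lambda>u. f (\<Psi> u)"]) (simp add: f)
  then show False using h(2) u(2) by simp
qed

text \<open>It is enough that \<open>\<Phi>\<^sup>d g = g\<close> for some \<open>d > 0\<close>: then \<open>g = \<Phi> h\<close>, so \<open>\<Phi> (\<Phi> x) = \<Phi> (h x h\<inverse>)\<close> and \<open>\<Phi>\<close> is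
  conjugation by \<open>h\<close>.  The defect \<open>c = \<Phi>(g)\<inverse> g\<close> centralizes the image of \<open>\<Psi> = \<Phi> \<circ> \<Phi>\<close>, because
  \<open>\<Phi> \<circ> \<Phi> \<circ> \<Phi>\<close> can be computed from \<open>\<Psi>\<close> in two ways.  Conjugation by \<open>g\<close> maps \<open>\<Psi>(G)\<close> into itself, so
  all \<open>g\<^sup>-\<^sup>i c g\<^sup>i\<close> centralize \<open>\<Psi>(G)\<close> as well, and two of them must coincide by
  \<open>no_displacing_centralizer\<close>.\<close>

lemma FR_surj_if_inner_on_image:
  assumes FR: "property_FR G" and \<Phi>: "\<Phi> \<in> hom G G" "inj_on \<Phi> (carrier G)" and infG: "infinite (carrier G)"
    and g: "g \<in> carrier G" and inner: "\<And>x. x \<in> carrier G \<Longrightarrow> \<Phi> (\<Phi> x) = conj_by g (\<Phi> x)"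
  shows "\<Phi> ` carrier G = carrier G"
proof -
  interpret \<Phi>: group_hom G G \<Phi> by unfold_locales fact
  have \<Phi>c: "(\<Phi> ^^ i) x \<in> carrier G" if "x \<in> carrier G" for i x
    by (rule hom_carrier[OF hom_funpow[OF \<Phi>(1)] that])
  define \<Psi> where "\<Psi> x = \<Phi> (\<Phi> x)" for x
  have \<Psi>: "\<Psi> \<in> hom G G" using \<Phi>(1) unfolding hom_def \<Psi>_def by auto
  interpret \<Psi>: group_hom G G \<Psi> by unfold_locales fact
  have inj\<Psi>: "inj_on \<Psi> (carrier G)"
    using \<Phi> unfolding \<Psi>_def inj_on_def by (metis hom_carrier)
  have \<Psi>\<Phi>: "conj_by (g [^] i) (\<Psi> x) = \<Psi> ((\<Phi> ^^ i) x)" if "x \<in> carrier G" for i x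
  proof (induction i)
    case (Suc i)
    have "conj_by (g [^] Suc i) (\<Psi> x) = conj_by g (conj_by (g [^] i) (\<Psi> x))"
      using that g nat_pow_Suc2[OF g, of i] by (simp add: conj_by_conj_by)
    also have "\<dots> = conj_by g (\<Phi> (\<Phi> ((\<Phi> ^^ i) x)))" unfolding Suc by (simp add: \<Psi>_def)
    also have "\<dots> = \<Psi> ((\<Phi> ^^ Suc i) x)" using inner[of "\<Phi> ((\<Phi> ^^ i) x)"] \<Phi>c[OF that, of "Suc i"] by (simp add: \<Psi>_def)
    finally show ?case .
  qed (use that in simp)
  define c where "c = inv (\<Phi> g) \<otimes> g"
  have c: "c \<in> carrier G" using g by (simp add: c_def)
  have cfix: "conj_by c (\<Psi> x) = \<Psi> x" if "x \<in> carrier G" for x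
  proof -
    have "conj_by g (\<Psi> x) = \<Phi> (conj_by g (\<Phi> x))"
      using inner[of "\<Phi> x", symmetric] inner[OF that, symmetric] that by (simp add: \<Psi>_def)
    also have "\<dots> = conj_by (\<Phi> g) (\<Psi> x)" using hom_conj_by[OF \<Phi>(1) g] that by (simp add: \<Psi>_def)
    finally show ?thesis using that g by (simp add: c_def conj_by_conj_by[symmetric] conj_by_inv_cancel)
  qed
  define z where "z i = conj_by (inv (g [^] i)) c" for i :: nat
  have zc: "z i \<in> carrier G" for i using g c by (simp add: z_def)
  have comm: "z i \<otimes> \<Psi> x = \<Psi> x \<otimes> z i" if x: "x \<in> carrier G" for i x
  proof -
    let ?g = "g [^] i"
    have "conj_by (z i) (\<Psi> x) = conj_by (inv ?g) (conj_by c (conj_by ?g (\<Psi> x)))"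
      using x g c by (simp add: conj_by_conj_by) (simp add: z_def conj_by_def m_assoc)
    also have "\<dots> = \<Psi> x" using x g by (simp add: \<Psi>\<Phi> cfix \<Phi>c) (simp add: conj_by_inv_cancel flip: \<Psi>\<Phi>)
    finally show ?thesis using x zc by (simp add: conj_by_eq_iff_commute)
  qed
  have step: "len (z (Suc i)) \<le> len (z i) + 2 * len g" for i
  proof -
    have "z (Suc i) = conj_by (inv g) (z i)" using g c by (simp add: z_def conj_by_conj_by inv_mult_group)
    then show ?thesis using len_conj_by_le[of "inv g" "z i"] g zc len_inv[OF g] by simp
  qed
  have "\<not> inj z"
  proof
    assume "inj z"
    then have infz: "infinite (range z)" using finite_imageD infinite_UNIV_nat by blast
    have "\<exists>i. r k \<le> len (z i)" for k
    proof (rule ccontr)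
      assume "\<not> ?thesis"
      then have "len (z i) \<le> nat \<lfloor>r k\<rfloor>" for i
        by (intro le_nat_floor) (simp add: not_le less_imp_le)
      then have "range z \<subseteq> {h \<in> carrier G. len h \<le> nat \<lfloor>r k\<rfloor>}" using zc by auto
      then show False using infz finite_subset[OF _ finite_ball] by metis
    qed
    define i where "i k = (LEAST i. r k \<le> len (z i))" for k
    have i1: "r k \<le> len (z (i k))" for k unfolding i_def using \<open>\<exists>i. r k \<le> len (z i)\<close> by (rule LeastI_ex)
    have i2: "len (z (i k)) \<le> r k + (len (z 0) + 2 * len g)" for k
    proof (cases "i k")
      case 0
      then show ?thesis using r_pos[of k] by simp
    next
      case (Suc j)
      then have "len (z j) < r k" using not_less_Least[of j "\<lambda>i. r k \<le> len (z i)"] by (simp add: i_def)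
      then show ?thesis using step[of j] Suc by simp
    qed
    obtain C where C: "\<And>s. s \<in> S \<Longrightarrow> len (\<Phi> s) \<le> C" using hom_letter_bound[of \<Phi>] by blast
    have "infinite (\<Phi> ` carrier G)" using infG \<Phi>(2) finite_imageD by blast
    \<comment> \<open>The elements \<open>\<Phi> (y k)\<close> have length about \<open>r k\<close>, and so have their images under \<open>\<Psi>\<close>, which are
      conjugates by \<open>g \<otimes> g\<close>: this is the witness that \<open>\<Psi>\<close> does not collapse the cone.\<close>
    from hom_image_length[OF \<Phi>(1) C this less_imp_le[OF r_pos]]
    obtain y where y: "y k \<in> carrier G" "r k \<le> len (\<Phi> (y k))" "len (\<Phi> (y k)) \<le> r k + C" for k by metis
    have xb: "(\<lambda>k. \<Phi> (y k)) \<in> bounded_seqs"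
    proof (rule bounded_seqsI[where C = 2])
      show "\<forall>\<^sub>F k in \<omega>. len (\<Phi> (y k)) \<le> 2 * r k"
        using eventually_r_ge[of "real C"] by eventually_elim (use y(3) in \<open>smt (verit)\<close>)
    qed (use y in simp)
    have \<Psi>xb: "(\<lambda>k. \<Psi> (\<Phi> (y k))) \<in> bounded_seqs"
    proof -
      obtain C' where C': "\<And>s. s \<in> S \<Longrightarrow> len (\<Psi> s) \<le> C'" using hom_letter_bound[of \<Psi>] by blast
      show ?thesis by (rule bounded_seqs_hom[OF \<Psi> C' xb])
    qed
    have ge: "r k \<le> len (\<Psi> (\<Phi> (y k))) + 4 * len g" for k
    proof -
      have "\<Psi> (\<Phi> (y k)) = conj_by g (\<Phi> (\<Phi> (y k)))" unfolding \<Psi>_def using y(1) by (intro inner) simp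
      also have "\<dots> = conj_by g (conj_by g (\<Phi> (y k)))" using inner[OF y(1)] by simp
      finally show ?thesis
        using len_conj_by_ge[of g "\<Phi> (y k)"] len_conj_by_ge[of g "conj_by g (\<Phi> (y k))"] g y(1,2)[of k] by simp
    qed
    \<comment> \<open>The constant \<open>1 / 2\<close> absorbs the bounded loss \<open>4 * len g\<close>; any positive lower bound would do.\<close>
    have "1 / 2 \<le> lim_dist (\<lambda>k. \<one>) (\<lambda>k. \<Psi> (\<Phi> (y k)))"
    proof (rule lim_dist_geI[OF _ \<Psi>xb])
      show "\<forall>\<^sub>F k in \<omega>. 1 / 2 * r k \<le> wd \<one> (\<Psi> (\<Phi> (y k)))"
        using eventually_r_ge[of "8 * real (len g)"]
      proof eventually_elim
        case (elim k)
        then show ?case using ge[of k] y(1)[of k] by (simp add: wd_one)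
      qed
    qed simp
    then have "0 < lim_dist (\<lambda>k. \<one>) (\<lambda>k. \<Psi> (\<Phi> (y k)))" by simp
    moreover have "infinite (\<Psi> ` carrier G)" using infG inj\<Psi> finite_imageD by blast
    ultimately show False
      using no_displacing_centralizer[OF FR \<Psi> _ xb _ zc i1 i2 comm] by blast
  qed
  then obtain i j where ij: "i < j" "z i = z j" by (metis injI linorder_neqE_nat)
  define d where "d = j - i"
  have "g [^] j = g [^] d \<otimes> g [^] i" using ij(1) g by (simp add: d_def nat_pow_mult)
  then have "conj_by (g [^] d) c = conj_by (g [^] j) (z i)" using g c by (simp add: z_def conj_by_conj_by m_assoc)
  also have "\<dots> = c" using g c by (simp add: ij(2)) (simp add: z_def conj_by_inv_cancel)
  finally have dc: "conj_by (g [^] d) c = c" .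
  have it: "(\<Phi> ^^ Suc k) g = conj_by (g [^] k) (\<Phi> g)" for k
  proof (induction k)
    case (Suc k)
    have "(\<Phi> ^^ Suc (Suc k)) g = conj_by g ((\<Phi> ^^ Suc k) g)" using inner \<Phi>c[OF g] by simp
    also have "\<dots> = conj_by (g [^] Suc k) (\<Phi> g)" unfolding Suc using g nat_pow_Suc2[OF g, of k] by (simp add: conj_by_conj_by)
    finally show ?case .
  qed (use g in simp)
  have \<Phi>g: "\<Phi> g = g \<otimes> inv c" using g by (simp add: c_def inv_mult_group) (simp flip: m_assoc)
  have "conj_by (g [^] d) g = g" using g nat_pow_Suc2[OF g, of d] by (simp add: conj_by_eq_iff_commute)
  then have "\<Phi> ((\<Phi> ^^ d) g) = \<Phi> g"
    using it[of d] g c dc by (simp add: \<Phi>g conj_by_mult conj_by_inv)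
  then have fixg: "(\<Phi> ^^ d) g = g" using \<Phi>(2) \<Phi>c[OF g] g by (meson inj_onD)
  have "d = Suc (d - 1)" using ij(1) by (simp add: d_def)
  then obtain h where h: "h \<in> carrier G" "g = \<Phi> h"
    using fixg \<Phi>c[OF g, of "d - 1"] by (metis comp_apply funpow.simps(2))
  have "\<Phi> x = conj_by h x" if "x \<in> carrier G" for x
  proof -
    have "\<Phi> (\<Phi> x) = \<Phi> (conj_by h x)" using inner[OF that] hom_conj_by[OF \<Phi>(1) h(1) that] h(2) by simp
    then show ?thesis using \<Phi>(2) that h(1) by (meson inj_onD \<Phi>.hom_closed conj_by_closed)
  qed
  then have pre: "y = \<Phi> (conj_by (inv h) y)" if "y \<in> carrier G" for y using that h(1) by (simp add: conj_by_inv_cancel)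
  show ?thesis
  proof (rule antisym)
    show "carrier G \<subseteq> \<Phi> ` carrier G"
    proof
      fix y assume y: "y \<in> carrier G"
      show "y \<in> \<Phi> ` carrier G" by (rule image_eqI, rule pre[OF y]) (use y h(1) in auto)
    qed
  qed auto
qed

end


theorem theorem1p5:
  fixes G :: "('a, 'm) monoid_scheme"
  assumes "group G"
    and "lacunary_hyperbolic G"
    and "property_FR G"
  shows "co_Hopfian G"
  unfolding co_Hopfian_def
proof (intro ballI impI)
  fix \<phi> assume \<phi>: "\<phi> \<in> hom G G" "inj_on \<phi> (carrier G)"
  interpret group G by fact
  have "\<phi> ` carrier G = carrier G"
  proof (cases "finite (carrier G)")
    case True
    then show ?thesis using \<phi> by (intro endo_inj_surj) (auto simp: hom_def)
  next
    case False
    obtain S \<omega> r where cone: "finite S" "generating_set G S" "nonprincipal_ultrafilter \<omega>"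
      "\<forall>n. 0 < r n" "filterlim r at_top sequentially"
      "real_tree (asymptotic_cone G S \<omega> r) (asymptotic_cone_dist G S \<omega> r)"
      using assms(2) unfolding lacunary_hyperbolic_def by blast
    interpret tree_cone G S \<omega> r by unfold_locales (use cone in blast)+
    obtain n p g where "0 < p" "g \<in> carrier G"
      "\<And>x. x \<in> carrier G \<Longrightarrow> (\<phi> ^^ (n + p)) x = conj_by g ((\<phi> ^^ n) x)"
      using FR_conjugate_powers[OF assms(3) \<phi>(1)] by blast
    from eventually_inner_power[OF \<phi>(1) this(2,1,3)]
    obtain q h where q: "0 < q" "h \<in> carrier G"
      "\<And>x. x \<in> carrier G \<Longrightarrow> (\<phi> ^^ q) ((\<phi> ^^ q) x) = conj_by h ((\<phi> ^^ q) x)" by blast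
    have "inj_on (\<phi> ^^ i) (carrier G)" for i
    proof (induction i)
      case (Suc i)
      have "inj_on \<phi> ((\<phi> ^^ i) ` carrier G)"
        using \<phi>(2) hom_carrier[OF hom_funpow[OF \<phi>(1)]] by (auto intro: inj_on_subset)
      from comp_inj_on[OF Suc this] show ?case by (simp only: funpow.simps)
    qed simp
    then have surj: "(\<phi> ^^ q) ` carrier G = carrier G"
      using FR_surj_if_inner_on_image[OF assms(3) hom_funpow[OF \<phi>(1)] _ False q(2,3)] by blast
    obtain p where "q = Suc p" using q(1) gr0_conv_Suc by blast
    then have "carrier G = \<phi> ` ((\<phi> ^^ p) ` carrier G)" using surj by (simp add: image_comp)
    also have "\<dots> \<subseteq> \<phi> ` carrier G" using hom_carrier[OF hom_funpow[OF \<phi>(1)]] by (intro image_mono) auto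
    finally show ?thesis using hom_carrier[OF \<phi>(1)] by blast
  qed
  then show "\<phi> \<in> iso G G" using \<phi> by (simp add: iso_def bij_betw_def)
qed

end
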